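(* Let $(p_n)_{n\in\mathbb Z}$ be a strictly increasing doubly infinite sequence of real numbers such that (a) $\cdots<p_{-2}<p_{-1}<0\le p_0<p_1<\cdots$; (b) the limit $\lim_{S\to\infty}\sum_{0<|p_n|<S}\frac1{p_n}$ exists (as a finite number); (c) $\lim_{n\to\pm\infty}\frac{p_n}{n}=1$. For $R>0$ let $w_R$ be the weight on $[-1,1]$ given by $$w_R(t)=\lim_{S\to\infty}\prod_{R<|p_n|<S}\Bigl(1-\frac{Rt}{p_n}\Bigr)^2,\qquad t\in[-1,1].$$ Let $N$ be an integer depending on $R$ in such a way that $\lim_{R\to\infty}\frac{N}{R}=2$. Then $$\lim_{R\to\infty}\frac2N K_N\Bigl(\frac{2x}{N},\frac{2y}{N};w_R\Bigr)=\frac{\sin\pi(x-y)}{\pi(x-y)}$$ uniformly for $x$ and $y$ in compact subsets of the real line.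
   Context: For a non-negative weight function $w$ on $\mathbb R$ (a weight given on an interval being regarded as zero outside it) with $\int|t|^n w(t)\,dt<\infty$ for all $n\ge0$, $(\varphi_j(\cdot;w))_{j\ge0}$ denotes the sequence of orthonormal polynomials: $\varphi_j(\cdot;w)$ is a polynomial of degree $j$ with positive leading coefficient and $\int\varphi_j(t;w)\varphi_k(t;w)w(t)\,dt=\delta_{jk}$. For $N\ge1$ the kernel is $$K_N(x,y;w)=\sqrt{w(x)w(y)}\sum_{j=0}^{N-1}\varphi_j(x;w)\varphi_j(y;w).$$ The limit defining $w_R$ exists because of assumption (b). The sine kernel $\frac{\sin\pi(x-y)}{\pi(x-y)}$ is understood to equal $1$ when $x=y$. *)

theory Defs
  imports "HOL-Analysis.Analysis" "HOL-Computational_Algebra.Polynomial"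
begin

definition orthonormal_polys :: "(real \<Rightarrow> real) \<Rightarrow> (nat \<Rightarrow> real poly) \<Rightarrow> bool" where
  "orthonormal_polys w \<phi> \<longleftrightarrow>
     (\<forall>j. degree (\<phi> j) = j \<and> lead_coeff (\<phi> j) > 0) \<and>
     (\<forall>j k. has_bochner_integral lborel (\<lambda>t. poly (\<phi> j) t * poly (\<phi> k) t * w t)
              (if j = k then 1 else 0))"

text \<open>For a non-negative weight with finite moments that does not vanish almost everywhere,
  the sequence exists and is unique, so the choice operator below is well-defined.\<close>

definition orthonormal_poly :: "(real \<Rightarrow> real) \<Rightarrow> nat \<Rightarrow> real poly" where
  "orthonormal_poly w = (THE \<phi>. orthonormal_polys w \<phi>)"

definition poly_kernel :: "nat \<Rightarrow> (real \<Rightarrow> real) \<Rightarrow> real \<Rightarrow> real \<Rightarrow> real" where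
  "poly_kernel N w x y = sqrt (w x * w y) *
     (\<Sum>j<N. poly (orthonormal_poly w j) x * poly (orthonormal_poly w j) y)"

text \<open>When \<open>p n / n\<close> tends to 1 at both ends, every index set below is finite.\<close>

definition zero_weight :: "(int \<Rightarrow> real) \<Rightarrow> real \<Rightarrow> real \<Rightarrow> real" where
  "zero_weight p R t =
     (if t \<in> {-1..1}
      then Lim at_top (\<lambda>S::real. \<Prod>n\<in>{n. R < \<bar>p n\<bar> \<and> \<bar>p n\<bar> < S}. (1 - R * t / p n)\<^sup>2)
      else 0)"

definition sine_kernel :: "real \<Rightarrow> real \<Rightarrow> real" where
  "sine_kernel x y = (if x = y then 1 else sin (pi * (x - y)) / (pi * (x - y)))"

end

theory Submission
  imports Defs
begin

text \<open>Put \<open>u = R t\<close> and \<open>E(u) = \<Prod>\<^bsub>|p\<^sub>n| > R\<^esub> (1 - u / p\<^sub>n)\<close>, so that \<open>w\<^sub>R(t) = E(u)\<^sup>2\<close> and the kernel is,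
  up to scaling, the reproducing kernel of the space of functions \<open>f = P E\<close> with \<open>deg P < N\<close>
  under the norm of \<open>L\<^sup>2(-R, R)\<close>.

  Upper bound on the diagonal: take nodes \<open>\<theta> + n \<rho>\<close> in \<open>[-R, R]\<close> with spacing \<open>\<rho>\<close> slightly below 1.
  There are more than \<open>N\<close> of them, so \<open>P\<close> is given by Lagrange interpolation, and because the nodes are
  denser than the zeros of \<open>E\<close>, the coefficient of \<open>f(\<theta> + n \<rho>)\<close> in \<open>f(v)\<close> is at most
  \<open>(1 + o(1)) |sinc ((v - \<theta>) / \<rho> - n)|\<close>.  Cauchy-Schwarz with \<open>\<Sum> sinc\<^sup>2 (x - n) \<le> 1\<close>, averaged over \<open>\<theta>\<close>,
  yields \<open>f(v)\<^sup>2 \<le> (1 + o(1)) \<parallel>f\<parallel>\<^sup>2 / \<rho>\<close>.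

  Lower bound: with spacing \<open>\<rho>\<close> slightly above 1, the product of \<open>E\<close> and the polynomial vanishing at the
  points \<open>v + n \<rho>\<close>, \<open>0 < |n| \<le> M\<close>, is dominated by \<open>(1 + o(1)) |sinc ((u - v) / \<rho>)|\<close> and close to
  \<open>sinc ((u - v) / \<rho>)\<close> on compact sets.

  As \<open>\<rho> \<rightarrow> 1\<close> the two bounds meet, and a function of almost minimal norm with almost maximal value at \<open>v\<close>
  is close to the reproducing element at \<open>v\<close>; this gives the off-diagonal limit as well.\<close>

subsection \<open>Orthonormal polynomials and their kernel\<close>

text \<open>The product \<open>E\<close> converges only conditionally, so it cannot be estimated
  factor by factor. Its logarithm is split as \<open>- eta R * u - tail p R u\<close>. The tail is
  an absolutely convergent sum of nonnegative terms and is compared with the corresponding sum over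
  the integers along an injection of index sets; only the order of magnitude and the signs of the
  zeros enter. The coefficient \<open>eta R\<close> tends to 0 at no known rate while
  \<open>u\<close> runs up to \<open>R\<close>, so the linear term is merely o(R). Factors (1 +
  x/m)^m with \<open>m\<close> a small multiple of \<open>R\<close> cancel it, and the degrees they
  cost are supplied by the deviation of the node spacing from 1. Near the ends of
  \<open>[-R, R]\<close> precise asymptotics of \<open>E\<close> are out of reach, since zeros may
  lie just outside. Nodes denser than the zeros for one bound and sparser for the other leave room
  to work with inequalities between tails in a single direction, with errors that are uniform up to
  the ends.\<close>

lemma degree_diff_cancel_less:
  fixes p q :: "real poly"
  assumes "degree p = degree q" "lead_coeff p = lead_coeff q" "0 < degree p"
  shows "degree (p - q) < degree p"
proof -
  have "degree (p - q) \<le> degree p" using assms by (simp add: degree_diff_le)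
  moreover have "coeff (p - q) (degree p) = 0" using assms by simp
  ultimately show ?thesis
    using assms(3) by (metis degree_0 eq_zero_or_degree_less)
qed

locale poly_weight =
  fixes w :: "real \<Rightarrow> real"
  assumes integrable_poly: "integrable lborel (\<lambda>t. poly q t * w t)"
    and positive: "q \<noteq> 0 \<Longrightarrow> 0 < (\<integral>t. poly (q * q) t * w t \<partial>lborel)"
begin

definition ip :: "real poly \<Rightarrow> real poly \<Rightarrow> real" where
  "ip p q = (\<integral>t. poly (p * q) t * w t \<partial>lborel)"

lemma ip_commute: "ip p q = ip q p"
  by (simp add: ip_def mult.commute)

lemma ip_add_left: "ip (p + q) r = ip p r + ip q r"
proof -
  have "ip (p + q) r = (\<integral>t. poly (p * r) t * w t + poly (q * r) t * w t \<partial>lborel)"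
    unfolding ip_def by (rule Bochner_Integration.integral_cong) (auto simp: algebra_simps)
  also have "\<dots> = ip p r + ip q r"
    unfolding ip_def by (rule Bochner_Integration.integral_add; rule integrable_poly)
  finally show ?thesis .
qed

lemma ip_smult_left: "ip (smult c p) r = c * ip p r"
proof -
  have "ip (smult c p) r = (\<integral>t. c * (poly (p * r) t * w t) \<partial>lborel)"
    unfolding ip_def by (rule Bochner_Integration.integral_cong) (auto simp: algebra_simps)
  then show ?thesis by (simp add: ip_def)
qed

lemma ip_zero_left: "ip 0 r = 0"
  by (simp add: ip_def)

lemma ip_diff_left: "ip (p - q) r = ip p r - ip q r"
  using ip_add_left[of p "- q" r] ip_smult_left[of "-1" q r] by simp

lemma ip_sum_left: "ip (\<Sum>i\<in>A. f i) r = (\<Sum>i\<in>A. ip (f i) r)"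
  by (induction A rule: infinite_finite_induct) (auto simp: ip_zero_left ip_add_left)

lemma ip_diff_right: "ip p (q - r) = ip p q - ip p r"
  by (metis ip_commute ip_diff_left)

lemma ip_smult_right: "ip p (smult c q) = c * ip p q"
  by (metis ip_commute ip_smult_left)

lemma ip_sum_right: "ip r (\<Sum>i\<in>A. f i) = (\<Sum>i\<in>A. ip r (f i))"
  using ip_sum_left[of f A r] by (simp add: ip_commute)

lemma ip_self_pos: "q \<noteq> 0 \<Longrightarrow> 0 < ip q q"
  unfolding ip_def by (rule positive)

text \<open>The \<open>e k\<close> run through all degrees below \<open>n\<close>, so a multiple of
  one of them removes the leading term of \<open>r\<close> without changing
  \<open>ip q r\<close>.\<close>

lemma orthogonal_to_lower_degree:
  assumes deg: "\<And>k. k < n \<Longrightarrow> degree (e k) = k \<and> e k \<noteq> 0"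
    and orth: "\<And>k. k < n \<Longrightarrow> ip q (e k) = 0"
    and "degree r < n"
  shows "ip q r = 0"
  using assms(3)
proof (induction "degree r" arbitrary: r rule: less_induct)
  case less
  define k where "k = degree r"
  define c where "c = lead_coeff r / lead_coeff (e k)"
  have k: "k < n" "degree (e k) = k" "e k \<noteq> 0" "ip q (e k) = 0"
    using less deg orth k_def by auto
  define s where "s = r - smult c (e k)"
  have q: "ip q s = ip q r"
    by (simp add: s_def ip_diff_right ip_smult_right k)
  show ?case
  proof (cases "s = 0")
    case True
    then show ?thesis using q by (metis ip_zero_left ip_commute)
  next
    case False
    \<comment> \<open>In degree 0 the degree cannot drop; there \<open>s\<close> is 0, against the
      case assumption.\<close>
    have "degree s < degree r"
    proof (cases "k = 0")
      case True
      obtain a where a: "r = [:a:]" using True k_def by (metis degree_eq_zeroE)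
      obtain b where b: "e k = [:b:]" using True k by (metis degree_eq_zeroE)
      have "s = 0" using k(3) by (simp add: s_def c_def a b)
      then show ?thesis using False by simp
    next
      case nz: False
      have "c \<noteq> 0" "coeff (e k) (degree (e k)) \<noteq> 0" using k(3) nz k_def by (auto simp: c_def)
      then show ?thesis unfolding s_def
        by (intro degree_diff_cancel_less) (use \<open>coeff (e k) (degree (e k)) \<noteq> 0\<close> \<open>c \<noteq> 0\<close> k nz in \<open>simp_all add: c_def flip: k_def\<close>)
    qed
    then show ?thesis using less q by force
  qed
qed

text \<open>Gram-Schmidt without normalisation: the projection of \<open>monom 1 n\<close> on the
  earlier monic polynomials is removed.\<close>

lemma monic_orthogonal_exists:
  "\<exists>q. degree q = n \<and> lead_coeff q = 1 \<and> (\<forall>r. degree r < n \<longrightarrow> ip q r = 0)"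
proof (induction n rule: less_induct)
  case (less n)
  then obtain e where e: "\<And>k. k < n \<Longrightarrow> degree (e k) = k \<and> lead_coeff (e k) = 1 \<and>
      (\<forall>r. degree r < k \<longrightarrow> ip (e k) r = 0)" by metis
  have nz: "e k \<noteq> 0" if "k < n" for k using e[OF that] by auto
  define s where "s = (\<Sum>k<n. smult (ip (monom 1 n) (e k) / ip (e k) (e k)) (e k))"
  define q where "q = monom 1 n - s"
  have s0: "coeff s i = 0" if "i \<ge> n" for i
    unfolding s_def using e that by (auto simp: coeff_sum coeff_eq_0 intro!: sum.neutral)
  have lc: "coeff q n = 1" by (simp add: q_def s0)
  have "degree q \<le> n"
    by (rule degree_le) (auto simp: q_def s0)
  then have deg: "degree q = n" using lc by (metis le_antisym le_degree zero_neq_one)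
  have ortho: "ip (e j) (e k) = 0" if "j < n" "k < n" "j \<noteq> k" for j k
    using e[OF that(1)] e[OF that(2)] that by (metis ip_commute nat_neq_iff)
  have "ip q (e k) = 0" if "k < n" for k
  proof -
    have "ip s (e k) = (\<Sum>j<n. ip (monom 1 n) (e j) / ip (e j) (e j) * ip (e j) (e k))"
      by (simp add: s_def ip_sum_left ip_smult_left)
    also have "\<dots> = (\<Sum>j<n. if j = k then ip (monom 1 n) (e k) else 0)"
      by (rule sum.cong) (use ortho that ip_self_pos[OF nz[OF that]] in auto)
    also have "\<dots> = ip (monom 1 n) (e k)" using that by simp
    finally show ?thesis by (simp add: q_def ip_diff_left)
  qed
  then have "ip q r = 0" if "degree r < n" for r
    using orthogonal_to_lower_degree[of n e q r] e nz that by auto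
  then show ?case using deg lc by blast
qed

lemma orthonormal_polys_iff:
  "orthonormal_polys w \<phi> \<longleftrightarrow>
     (\<forall>j. degree (\<phi> j) = j \<and> lead_coeff (\<phi> j) > 0) \<and>
     (\<forall>j k. ip (\<phi> j) (\<phi> k) = (if j = k then 1 else 0))"
proof -
  have "has_bochner_integral lborel (\<lambda>t. poly p t * poly q t * w t) c \<longleftrightarrow> ip p q = c" for p q c
    using integrable_poly[of "p * q"] by (auto simp: has_bochner_integral_iff ip_def)
  then show ?thesis by (simp add: orthonormal_polys_def)
qed

lemma orthonormal_polys_exists: "\<exists>\<phi>. orthonormal_polys w \<phi>"
proof -
  obtain q where q: "\<And>n. degree (q n) = n \<and> lead_coeff (q n) = 1 \<and> (\<forall>r. degree r < n \<longrightarrow> ip (q n) r = 0)"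
    using monic_orthogonal_exists by metis
  have nz: "q n \<noteq> 0" for n using q[of n] by auto
  define \<phi> where "\<phi> n = smult (1 / sqrt (ip (q n) (q n))) (q n)" for n
  have pos: "0 < ip (q n) (q n)" for n using ip_self_pos[OF nz] .
  have "ip (q j) (q k) = 0" if "j \<noteq> k" for j k
    using that q[of j] q[of k] by (metis ip_commute nat_neq_iff)
  then have "ip (\<phi> j) (\<phi> k) = (if j = k then 1 else 0)" for j k
    using pos[of k] by (auto simp: \<phi>_def ip_smult_left ip_smult_right)
  moreover have "degree (\<phi> j) = j \<and> lead_coeff (\<phi> j) > 0" for j
    using q[of j] pos[of j] by (auto simp: \<phi>_def)
  ultimately show ?thesis unfolding orthonormal_polys_iff by blast
qed

lemma orthonormal_polys_unique:
  assumes "orthonormal_polys w \<phi>" "orthonormal_polys w \<psi>"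
  shows "\<phi> = \<psi>"
proof
  fix n
  have orth: "ip (\<theta> n) r = 0" if "orthonormal_polys w \<theta>" "degree r < n" for \<theta> r
  proof (rule orthogonal_to_lower_degree[where e = \<theta> and n = n])
    show "degree (\<theta> k) = k \<and> \<theta> k \<noteq> 0" for k
      using that(1) unfolding orthonormal_polys_iff by (metis leading_coeff_0_iff less_irrefl)
    show "ip (\<theta> n) (\<theta> k) = 0" if "k < n" for k
      using \<open>orthonormal_polys w \<theta>\<close> that unfolding orthonormal_polys_iff by auto
  qed (use that in auto)
  define a where "a = lead_coeff (\<phi> n)"
  define b where "b = lead_coeff (\<psi> n)"
  have pos: "a > 0" "b > 0"
    using assms unfolding orthonormal_polys_iff a_def b_def by blast+
  have deg: "degree (\<phi> n) = n" "degree (\<psi> n) = n" "ip (\<phi> n) (\<phi> n) = 1" "ip (\<psi> n) (\<psi> n) = 1"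
    using assms unfolding orthonormal_polys_iff by auto
  note ab = pos deg
  \<comment> \<open>Cross-multiplication by the leading coefficients makes the degree drop below
    \<open>n\<close>, so \<open>d\<close> is orthogonal to both polynomials and hence to
    itself.\<close>
  define d where "d = smult b (\<phi> n) - smult a (\<psi> n)"
  have "d = 0"
  proof (cases "n = 0")
    case True
    obtain x y where "\<phi> n = [:x:]" "\<psi> n = [:y:]" using ab True by (metis degree_eq_zeroE)
    then show ?thesis by (simp add: d_def a_def b_def)
  next
    case False
    have "degree d < degree (smult b (\<phi> n))" unfolding d_def
      by (intro degree_diff_cancel_less) (use ab False in \<open>auto simp: a_def b_def\<close>)
    then have dd: "degree d < n" using ab by simp
    have "ip d d = 0"
      using orth[OF assms(1) dd] orth[OF assms(2) dd]
      by (subst (1) d_def) (simp add: ip_diff_left ip_smult_left)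
    then show ?thesis using ip_self_pos[of d] by force
  qed
  then have eq: "smult b (\<phi> n) = smult a (\<psi> n)" by (simp add: d_def)
  have "ip (smult b (\<phi> n)) (smult b (\<phi> n)) = ip (smult a (\<psi> n)) (smult a (\<psi> n))"
    by (simp only: eq)
  then have "b * b = a * a"
    using ab by (simp add: ip_smult_left ip_smult_right)
  then have "a = b" using ab by (simp add: square_eq_iff)
  then show "\<phi> n = \<psi> n" using eq ab by (metis less_irrefl smult_cancel)
qed

lemma orthonormal_poly: "orthonormal_polys w (orthonormal_poly w)"
  unfolding orthonormal_poly_def
  using orthonormal_polys_exists orthonormal_polys_unique by (metis theI')

section \<open>The reproducing polynomial and pointwise values of the kernel\<close>

definition repr_poly :: "nat \<Rightarrow> real \<Rightarrow> real poly" where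
  "repr_poly N y = (\<Sum>j<N. smult (poly (orthonormal_poly w j) y) (orthonormal_poly w j))"

lemma poly_kernel_eq: "poly_kernel N w x y = sqrt (w x * w y) * poly (repr_poly N y) x"
  unfolding poly_kernel_def repr_poly_def by (simp add: poly_sum mult.commute)

lemma degree_repr_poly:
  assumes "N > 0" shows "degree (repr_poly N y) < N"
proof -
  have "degree (repr_poly N y) \<le> N - 1"
    unfolding repr_poly_def
    by (rule degree_sum_le) (use orthonormal_poly in \<open>auto simp: orthonormal_polys_def intro!: le_trans[OF degree_smult_le]\<close>)
  then show ?thesis using assms by simp
qed

lemma ip_repr_poly:
  assumes "degree p < N"
  shows "ip p (repr_poly N y) = poly p y"
proof -
  let ?\<phi> = "orthonormal_poly w"
  have ip\<phi>: "ip (?\<phi> j) (?\<phi> k) = (if j = k then 1 else 0)" for j k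
    using orthonormal_poly unfolding orthonormal_polys_iff by blast
  have deg: "degree (?\<phi> k) = k \<and> ?\<phi> k \<noteq> 0" for k
    using orthonormal_poly unfolding orthonormal_polys_iff by (metis leading_coeff_0_iff less_irrefl)
  define d where "d = p - (\<Sum>j<N. smult (ip p (?\<phi> j)) (?\<phi> j))"
  have d0: "ip d (?\<phi> k) = 0" if "k < N" for k
  proof -
    have "(\<Sum>j<N. ip p (?\<phi> j) * ip (?\<phi> j) (?\<phi> k)) = (\<Sum>j<N. if j = k then ip p (?\<phi> k) else 0)"
      by (rule sum.cong) (auto simp: ip\<phi>)
    then show ?thesis using that
      by (simp add: d_def ip_diff_left ip_sum_left ip_smult_left)
  qed
  have "degree (\<Sum>j<N. smult (ip p (?\<phi> j)) (?\<phi> j)) \<le> N - 1"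
    by (rule degree_sum_le) (use deg in \<open>auto intro!: le_trans[OF degree_smult_le]\<close>)
  then have "degree d \<le> N - 1" unfolding d_def using assms by (intro degree_diff_le) auto
  then have "ip d d = 0"
    using orthogonal_to_lower_degree[of N ?\<phi> d d] deg d0 assms by auto
  then have "d = 0" using ip_self_pos[of d] by force
  then have "p = (\<Sum>j<N. smult (ip p (?\<phi> j)) (?\<phi> j))" by (simp add: d_def)
  then have "poly p y = (\<Sum>j<N. ip p (?\<phi> j) * poly (?\<phi> j) y)"
    by (metis (no_types, lifting) poly_smult poly_sum sum.cong)
  then show ?thesis by (simp add: repr_poly_def ip_sum_right ip_smult_right mult.commute)
qed

text \<open>A polynomial whose norm and value at \<open>y\<close> both almost attain the diagonal bound is
  almost the reproducing element, so pointwise values of the kernel can be read off from it.\<close>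

lemma poly_kernel_approx:
  assumes N: "degree f < N" and w: "0 \<le> w x" "0 \<le> w y"
    and bound: "\<And>q z. degree q < N \<Longrightarrow> z \<in> {x, y} \<Longrightarrow> (poly q z)\<^sup>2 * w z \<le> B * ip q q"
    and norm: "ip f f \<le> C"
  shows "(poly_kernel N w x y - sqrt (w x) * poly f x)\<^sup>2 \<le> B * (B - 2 * sqrt (w y) * poly f y + C)"
proof -
  define k where "k = smult (sqrt (w y)) (repr_poly N y)"
  have degk: "degree (repr_poly N y) < N" using degree_repr_poly N by force
  have kk: "ip (repr_poly N y) (repr_poly N y) = poly (repr_poly N y) y"
    using ip_repr_poly[OF degk] .
  \<comment> \<open>With \<open>K = ip k k\<close> for \<open>k = repr_poly N y\<close>, which is
    also its value at \<open>y\<close>, the bound at \<open>y\<close> reads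
    \<open>K * K * w y <= B * K\<close>; \<open>K\<close> cancels unless the polynomial
    vanishes.\<close>
  have B: "poly (repr_poly N y) y * w y \<le> B \<or> repr_poly N y = 0"
    using bound[OF degk, of y] ip_self_pos[of "repr_poly N y"]
    by (auto simp: kk power2_eq_square mult_ac)
  have "ip k k = w y * poly (repr_poly N y) y"
    using w by (simp add: k_def ip_smult_left ip_smult_right kk)
  moreover have "0 \<le> B"
  proof -
    have "0 \<le> w y * 1" using w by simp
    also have "\<dots> \<le> B * ip 1 1" using bound[of 1 y] N by simp
    finally show ?thesis using ip_self_pos[of 1] by (simp add: zero_le_mult_iff)
  qed
  ultimately have ipkk: "ip k k \<le> B" using B by (auto simp: mult.commute)
  have ipfk: "ip f k = sqrt (w y) * poly f y"
    by (simp add: k_def ip_smult_right ip_repr_poly N)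
  define d where "d = k - f"
  have "degree k \<le> degree (repr_poly N y)" unfolding k_def by (rule degree_smult_le)
  then have "degree d < N" unfolding d_def using N degk
    by (intro degree_diff_less) auto
  then have "(poly d x)\<^sup>2 * w x \<le> B * ip d d" using bound by auto
  also have "ip d d = ip k k - 2 * ip f k + ip f f"
    by (simp add: d_def ip_diff_left ip_diff_right ip_commute[of k f])
  also have "B * \<dots> \<le> B * (B - 2 * sqrt (w y) * poly f y + C)"
    using ipkk ipfk norm \<open>0 \<le> B\<close> by (intro mult_left_mono) auto
  finally have "(poly d x)\<^sup>2 * w x \<le> B * (B - 2 * sqrt (w y) * poly f y + C)" .
  moreover have "(poly d x)\<^sup>2 * w x = (sqrt (w x) * poly d x)\<^sup>2"
    using w by (simp add: power_mult_distrib)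
  moreover have "sqrt (w x) * poly d x = poly_kernel N w x y - sqrt (w x) * poly f x"
    using w by (simp add: poly_kernel_eq d_def k_def real_sqrt_mult algebra_simps)
  ultimately show ?thesis by simp
qed

end

subsection \<open>The function sinc\<close>

definition sinc :: "real \<Rightarrow> real" where
  "sinc x = (if x = 0 then 1 else sin (pi * x) / (pi * x))"

lemma sine_kernel_eq_sinc: "sine_kernel x y = sinc (x - y)"
  by (auto simp: sine_kernel_def sinc_def)

lemma continuous_on_sinc: "continuous_on A sinc"
proof -
  have "isCont sinc x" for x
  proof (cases "x = 0")
    case True
    have "((\<lambda>x. sin (pi * x)) has_real_derivative pi) (at 0)"
      by (auto intro!: derivative_eq_intros)
    then have "((\<lambda>x. sin (pi * x) / x / pi) \<longlongrightarrow> pi / pi) (at 0)"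
      by (intro tendsto_intros) (auto simp: has_field_derivative_iff)
    then have "((\<lambda>x. sin (pi * x) / (pi * x)) \<longlongrightarrow> 1) (at 0)"
      by (simp add: mult.commute)
    then have "(sinc \<longlongrightarrow> 1) (at 0)"
      by (rule Lim_transform_eventually) (auto simp: sinc_def eventually_at_filter)
    then show ?thesis using True by (simp add: isCont_def sinc_def)
  next
    case False
    have "isCont (\<lambda>x. sin (pi * x) / (pi * x)) x" using False by (intro continuous_intros) auto
    moreover have "\<forall>\<^sub>F y in nhds x. sinc y = sin (pi * y) / (pi * y)"
      using False by (intro eventually_mono[OF t1_space_nhds[of x 0]]) (auto simp: sinc_def)
    ultimately show ?thesis using isCont_cong by metis
  qed
  then show ?thesis by (simp add: continuous_at_imp_continuous_on)
qed

lemma abs_sinc_le_1: "\<bar>sinc x\<bar> \<le> 1"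
  using abs_sin_x_le_abs_x[of "pi * x"] by (auto simp: sinc_def divide_le_eq_1)

text \<open>Herglotz's trick: iterating \<open>4 / sin\<^sup>2 (2x) = 1 / sin\<^sup>2 x + 1 / sin\<^sup>2 (x + \<pi>/2)\<close>.\<close>

lemma inverse_sin_squared_sum:
  assumes "sin (x::real) \<noteq> 0"
  shows "1 / (sin x)\<^sup>2 = (\<Sum>k<2^n. 1 / (sin ((x + real k * pi) / 2^n))\<^sup>2) / 4^n"
  using assms
proof (induction n arbitrary: x)
  case 0
  then show ?case by simp
next
  case (Suc n)
  have s2: "sin x = 2 * sin (x/2) * cos (x/2)" using sin_double[of "x/2"] by simp
  have c: "sin ((x + pi)/2) = cos (x/2)" by (simp add: add_divide_distrib sin_add)
  have nz: "sin (x/2) \<noteq> 0" "sin ((x+pi)/2) \<noteq> 0" using s2 c Suc.prems by auto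
  have "1 / (sin x)\<^sup>2 = (1 / (sin (x/2))\<^sup>2 + 1 / (sin ((x+pi)/2))\<^sup>2) / 4"
    unfolding c s2 using nz c sin_cos_squared_add[of "x/2"]
    by (simp add: power_mult_distrib add_frac_eq add.commute)
  also have "1 / (sin (x/2))\<^sup>2 = (\<Sum>k<2^n. 1 / (sin ((x + real (2*k) * pi) / 2^Suc n))\<^sup>2) / 4^n"
    unfolding Suc.IH[OF nz(1)] by (simp add: add_divide_distrib)
  also have "1 / (sin ((x+pi)/2))\<^sup>2 = (\<Sum>k<2^n. 1 / (sin ((x + real (2*k+1) * pi) / 2^Suc n))\<^sup>2) / 4^n"
    unfolding Suc.IH[OF nz(2)] by (simp add: add_divide_distrib algebra_simps)
  also have "((\<Sum>k<2^n. 1 / (sin ((x + real (2*k) * pi) / 2^Suc n))\<^sup>2) / 4^n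
     + (\<Sum>k<2^n. 1 / (sin ((x + real (2*k+1) * pi) / 2^Suc n))\<^sup>2) / 4^n) / 4
     = (\<Sum>k<2^n*2. 1 / (sin ((x + real k * pi) / 2^Suc n))\<^sup>2) / 4^Suc n"
    unfolding sum.nat_group[symmetric]
    by (simp add: sum.nat_group[symmetric, where k=2] sum.distrib add_divide_distrib[symmetric] numeral_2_eq_2 sum.atLeast_Suc_lessThan mult.commute)
  finally show ?case by (simp add: mult.commute)
qed

text \<open>\<open>\<bar>sin y\<bar> <= \<bar>y\<bar>\<close> applied to each term of the dyadic
  identity gives the upper half of the partial fraction expansion, in finite form.\<close>

lemma sum_inverse_squares_le:
  assumes "sin (x::real) \<noteq> 0"
  shows "(\<Sum>k<(2::nat)^n. 1 / (x + real k * pi)\<^sup>2) \<le> 1 / (sin x)\<^sup>2"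
proof -
  have "1 / (x + real k * pi)\<^sup>2 \<le> 1 / (sin ((x + real k * pi) / 2^n))\<^sup>2 / 4^n" for k
  proof -
    define y where "y = (x + real k * pi) / 2^n"
    have x: "x + real k * pi = y * 2^n" by (simp add: y_def)
    have e: "(4::real)^n = (2^n)\<^sup>2" by (simp add: power2_eq_square flip: power_mult_distrib)
    have "sin (x + real k * pi) \<noteq> 0" using assms by (simp add: sin_add)
    then have "sin y \<noteq> 0" unfolding y_def[symmetric] x
    proof (induction n)
      case (Suc n)
      then show ?case using sin_double[of "y * 2^n"] by (auto simp: mult_ac)
    qed auto
    moreover have "(sin y)\<^sup>2 \<le> y\<^sup>2" using abs_sin_x_le_abs_x by (simp add: abs_le_square_iff)
    ultimately have "1 / y\<^sup>2 / 4^n \<le> 1 / (sin y)\<^sup>2 / 4^n"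
      by (intro divide_right_mono divide_left_mono) (auto simp: zero_less_mult_iff)
    then show ?thesis unfolding y_def[symmetric] unfolding x by (simp add: power_mult_distrib e)
  qed
  then have "(\<Sum>k<(2::nat)^n. 1 / (x + real k * pi)\<^sup>2) \<le> (\<Sum>k<2^n. 1 / (sin ((x + real k * pi) / 2^n))\<^sup>2 / 4^n)"
    by (intro sum_mono)
  then show ?thesis using inverse_sin_squared_sum[OF assms, of n] by (simp add: sum_divide_distrib)
qed

lemma abs_sin_shift: "\<bar>sin (x + of_int n * pi)\<bar> = \<bar>sin (x::real)\<bar>"
proof -
  have "sin (of_int n * pi) = 0" by (simp add: sin_zero_iff_int2) 
  moreover have "\<bar>cos (of_int n * pi)\<bar> = 1"
    using calculation sin_zero_abs_cos_one by blast
  ultimately show ?thesis by (simp add: sin_add abs_mult)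
qed

text \<open>Off the integers all numerators have the same absolute value, so the sum is
  \<open>(sin y)\<^sup>2\<close> times a sum of inverse squares; at an integer a single term is 1
  and the others vanish.\<close>

lemma sum_sinc_squared_le_1:
  fixes x :: real
  shows "(\<Sum>n=-M..M. (sinc (x - of_int n))\<^sup>2) \<le> 1"
proof (cases "\<exists>m::int. x = of_int m")
  case True
  then obtain m :: int where m: "x = of_int m" by blast
  have "(sinc (x - of_int n))\<^sup>2 = (if n = m then 1 else 0)" for n
    using abs_sin_shift[of 0 "m - n"] by (auto simp: sinc_def m mult.commute)
  then show ?thesis by simp
next
  case False
  \<comment> \<open>Counting down from \<open>M\<close>, with \<open>n = M - k\<close>, turns the
    symmetric window into \<open>k = 0, ..., 2 * M\<close>, the shape of the inverse-square
    bound.\<close>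
  define y where "y = pi * (x - of_int M)"
  have nz: "x - of_int n \<noteq> 0" for n using False by (metis eq_iff_diff_eq_0)
  have s: "sin y \<noteq> 0"
  proof
    assume "sin y = 0"
    then obtain i :: int where "y = of_int i * pi" by (auto simp: sin_zero_iff_int2)
    then have "pi * x = pi * of_int (i + M)" by (simp add: y_def algebra_simps)
    then have "x = of_int (i + M)" using pi_neq_zero mult_cancel_left by blast
    then show False using False by blast
  qed
  define K where "K = nat (2 * M + 1)"
  have "(\<Sum>n=-M..M. (sinc (x - of_int n))\<^sup>2) = (\<Sum>k<K. (sinc (x - of_int M + real k))\<^sup>2)"
    by (rule sum.reindex_bij_witness[where i = "\<lambda>k. M - int k" and j = "\<lambda>n. nat (M - n)"]) (auto simp: K_def)
  also have "\<dots> = (\<Sum>k<K. (sin y)\<^sup>2 * (1 / (y + real k * pi)\<^sup>2))"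
  proof (rule sum.cong[OF refl])
    fix k
    have "sinc (x - of_int M + real k) = sin (y + real k * pi) / (y + real k * pi)"
      using nz[of "M - int k"] by (auto simp: sinc_def y_def algebra_simps)
    moreover have "(sin (y + real k * pi))\<^sup>2 = (sin y)\<^sup>2"
      using abs_sin_shift[of y "int k"] by (simp add: abs_eq_iff power2_eq_iff)
    ultimately show "(sinc (x - of_int M + real k))\<^sup>2 = (sin y)\<^sup>2 * (1 / (y + real k * pi)\<^sup>2)"
      by (simp add: power_divide)
  qed
  \<comment> \<open>The inverse-square bound is for a power of two many terms;
    \<open>K < 2^K\<close> and extra terms only enlarge the sum.\<close>
  also have "\<dots> \<le> (\<Sum>k<2^K. (sin y)\<^sup>2 * (1 / (y + real k * pi)\<^sup>2))"
    by (rule sum_mono2) (use less_exp[of K] in auto)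
  also have "\<dots> = (sin y)\<^sup>2 * (\<Sum>k<2^K. 1 / (y + real k * pi)\<^sup>2)" by (simp add: sum_distrib_left)
  also have "\<dots> \<le> (sin y)\<^sup>2 * (1 / (sin y)\<^sup>2)"
    by (intro mult_left_mono sum_inverse_squares_le s) auto
  also have "\<dots> = 1" using s by simp
  finally show ?thesis .
qed

subsection \<open>Folding an integral onto one period\<close>

text \<open>The half-open intervals of length \<open>r\<close> centred at the multiples of
  \<open>r\<close> tile the line. This serves both for the norm of sinc and for averaging over the
  offset of the nodes.\<close>

lemma integral_fold:
  fixes g :: "real \<Rightarrow> real"
  assumes g: "integrable lborel g" and r: "0 < r"
  shows "(LINT \<theta>|lborel. indicator {-r/2..<r/2} \<theta> * (\<Sum>n=-M..M. g (\<theta> + of_int n * r)))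
       = (LINT t|lborel. indicator {-(of_int M + 1/2) * r..<(of_int M + 1/2) * r} t * g t)"
    and "integrable lborel (\<lambda>\<theta>. indicator {-r/2..<r/2} \<theta> * (\<Sum>n=-M..M. g (\<theta> + of_int n * r)))"
proof -
  let ?I = "\<lambda>n::int. {(of_int n - 1/2) * r..<(of_int n + 1/2) * r}"
  have gi: "integrable lborel (\<lambda>t. indicator (?I n) t * g t)" for n
    using integrable_mult_indicator[OF _ g, of "?I n"] by simp
  have ind: "indicator (?I n) (of_int n * r + 1 * \<theta>) = indicator {-r/2..<r/2} \<theta>" for n \<theta>
    by (auto simp: indicator_def algebra_simps)
  have int: "integrable lborel (\<lambda>\<theta>. indicator {-r/2..<r/2} \<theta> * g (of_int n * r + 1 * \<theta>))" for n
    using lborel_integrable_real_affine[OF gi[of n], of 1 "of_int n * r"] unfolding ind by simp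
  have eq: "(LINT \<theta>|lborel. indicator {-r/2..<r/2} \<theta> * g (of_int n * r + 1 * \<theta>)) = (LINT t|lborel. indicator (?I n) t * g t)" for n
    using lborel_integral_real_affine[of 1 "\<lambda>t. indicator (?I n) t * g t" "of_int n * r"] unfolding ind by simp
  have e1: "(\<lambda>\<theta>. indicator {-r/2..<r/2} \<theta> * (\<Sum>n=-M..M. g (\<theta> + of_int n * r)))
     = (\<lambda>\<theta>. \<Sum>n=-M..M. indicator {-r/2..<r/2} \<theta> * g (of_int n * r + 1 * \<theta>))"
    by (simp add: sum_distrib_left add.commute)
  show "integrable lborel (\<lambda>\<theta>. indicator {-r/2..<r/2} \<theta> * (\<Sum>n=-M..M. g (\<theta> + of_int n * r)))"
    unfolding e1 by (intro Bochner_Integration.integrable_sum int)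
  have ind_sum: "(\<Sum>n=-M..M. indicator (?I n) t :: real) = indicator {-(of_int M + 1/2) * r..<(of_int M + 1/2) * r} t" for t
  proof -
    have "t \<in> ?I n \<longleftrightarrow> n = \<lfloor>t / r + 1/2\<rfloor>" for n
      using r by (auto simp: field_simps floor_eq_iff eq_commute[of n])
    then have "(\<Sum>n=-M..M. indicator (?I n) t :: real) = (\<Sum>n=-M..M. if n = \<lfloor>t / r + 1/2\<rfloor> then 1 else 0)"
      by (intro sum.cong) (auto simp: indicator_def)
    also have "\<dots> = (if \<lfloor>t / r + 1/2\<rfloor> \<in> {-M..M} then 1 else 0)" by simp
    also have "\<lfloor>t / r + 1/2\<rfloor> \<in> {-M..M} \<longleftrightarrow> t \<in> {-(of_int M + 1/2) * r..<(of_int M + 1/2) * r}"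
    proof -
      have "-M \<le> \<lfloor>t / r + 1/2\<rfloor> \<longleftrightarrow> -(of_int M + 1/2) * r \<le> t"
        using pos_le_divide_eq[OF r, of "-(of_int M + 1/2)" t] by (auto simp: le_floor_iff)
      moreover have "\<lfloor>t / r + 1/2\<rfloor> \<le> M \<longleftrightarrow> t < (of_int M + 1/2) * r"
        using r by (simp add: floor_le_iff field_simps)
      ultimately show ?thesis by auto
    qed
    finally show ?thesis by (simp add: indicator_def)
  qed
  have "(LINT \<theta>|lborel. indicator {-r/2..<r/2} \<theta> * (\<Sum>n=-M..M. g (\<theta> + of_int n * r)))
      = (\<Sum>n=-M..M. LINT t|lborel. indicator (?I n) t * g t)"
    unfolding e1 by (subst Bochner_Integration.integral_sum) (use int eq in auto)
  also have "\<dots> = (LINT t|lborel. (\<Sum>n=-M..M. indicator (?I n) t * g t))"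
    by (rule Bochner_Integration.integral_sum[symmetric]) (rule gi)
  finally show "(LINT \<theta>|lborel. indicator {-r/2..<r/2} \<theta> * (\<Sum>n=-M..M. g (\<theta> + of_int n * r)))
       = (LINT t|lborel. indicator {-(of_int M + 1/2) * r..<(of_int M + 1/2) * r} t * g t)"
    by (simp add: sum_distrib_right[symmetric] ind_sum)
qed

text \<open>Folded onto one period of length \<open>\<rho>\<close>, the integrand is at most 1 by
  the bound on sums of squared sincs; this takes the place of evaluating the integral over the
  line.\<close>

lemma integral_sinc_squared_le:
  fixes c \<rho> b :: real
  assumes "0 < \<rho>"
  shows "(LINT t|lborel. indicator {-b..b} t * (sinc ((t - c) / \<rho>))\<^sup>2) \<le> \<rho>"
proof -
  define M :: int where "M = \<lceil>\<bar>b\<bar> / \<rho>\<rceil>"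
  let ?J = "{-(of_int M + 1/2) * \<rho>..<(of_int M + 1/2) * \<rho>}"
  have "\<bar>b\<bar> / \<rho> \<le> of_int M" unfolding M_def by (rule le_of_int_ceiling)
  then have b: "\<bar>b\<bar> < (of_int M + 1/2) * \<rho>" using assms by (simp add: field_simps)
  define g where "g t = indicator {-b..b} t * (sinc ((t - c) / \<rho>))\<^sup>2" for t
  have g: "integrable lborel g"
  proof -
    have "integrable lborel (\<lambda>x. indicator {-b..b} x *\<^sub>R (sinc ((x - c) / \<rho>))\<^sup>2)"
      by (rule borel_integrable_compact) (use assms in \<open>auto intro!: continuous_intros continuous_on_compose2[OF continuous_on_sinc[of UNIV]]\<close>)
    then show ?thesis by (simp add: g_def[abs_def])
  qed
  have "(LINT t|lborel. g t) = (LINT t|lborel. indicator ?J t * g t)"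
    by (rule Bochner_Integration.integral_cong) (use b in \<open>auto simp: g_def indicator_def algebra_simps\<close>)
  also have "\<dots> = (LINT \<theta>|lborel. indicator {-\<rho>/2..<\<rho>/2} \<theta> * (\<Sum>n=-M..M. g (\<theta> + of_int n * \<rho>)))"
    by (rule integral_fold(1)[OF g assms, symmetric])
  also have "\<dots> \<le> (LINT \<theta>|lborel. indicator {-\<rho>/2..<\<rho>/2} \<theta>)"
  proof (rule integral_mono)
    show "integrable lborel (indicator {-\<rho>/2..<\<rho>/2} :: real \<Rightarrow> real)"
      using assms by (simp add: integrable_indicator_iff)
    fix \<theta>
    have "(\<Sum>n=-M..M. g (\<theta> + of_int n * \<rho>)) \<le> (\<Sum>n=-M..M. (sinc ((\<theta> - c) / \<rho> + of_int n))\<^sup>2)"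
    proof (rule sum_mono)
      fix n
      have "(\<theta> + of_int n * \<rho> - c) / \<rho> = (\<theta> - c) / \<rho> + of_int n" using assms by (simp add: field_simps)
      then show "g (\<theta> + of_int n * \<rho>) \<le> (sinc ((\<theta> - c) / \<rho> + of_int n))\<^sup>2"
        by (auto simp: g_def indicator_def)
    qed
    also have "\<dots> = (\<Sum>n=-M..M. (sinc ((\<theta> - c) / \<rho> - of_int n))\<^sup>2)"
      by (rule sum.reindex_bij_witness[where i = uminus and j = uminus]) auto
    also have "\<dots> \<le> 1" by (rule sum_sinc_squared_le_1)
    finally show "indicator {-\<rho>/2..<\<rho>/2} \<theta> * (\<Sum>n=-M..M. g (\<theta> + of_int n * \<rho>)) \<le> indicator {-\<rho>/2..<\<rho>/2} \<theta>"
      by (auto simp: indicator_def)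
  qed (rule integral_fold(2)[OF g assms])
  also have "\<dots> = \<rho>" using assms by simp
  finally show ?thesis unfolding g_def .
qed

subsection \<open>Logarithmic tails of canonical products\<close>

text \<open>Minus the logarithm of the genus-one primary factor \<open>(1 - x) * exp x\<close>.
  Being of second order at 0, it can be summed absolutely even where \<open>1 / a n\<close>
  cannot.\<close>

definition psi :: "real \<Rightarrow> real" where
  "psi x = - ln (1 - x) - x"

lemma psi_nonneg: "x < 1 \<Longrightarrow> 0 \<le> psi x"
  using ln_le_minus_one[of "1 - x"] by (simp add: psi_def)

lemma psi_le_square: "\<bar>x\<bar> \<le> 1/2 \<Longrightarrow> psi x \<le> 2 * x\<^sup>2"
  using abs_ln_one_plus_x_minus_x_bound[of "-x"] by (simp add: psi_def)

text \<open>\<open>psi\<close> decreases before 0 and increases after it. For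
  \<open>x \<noteq> 0\<close> the product hypothesis says, for both signs at once, that
  \<open>y\<close> lies at or beyond \<open>x\<close> on the same side of 0.\<close>

lemma psi_mono:
  assumes "x < 1" "y < 1" "0 \<le> (y - x) * x"
  shows "psi x \<le> psi y"
proof -
  have "ln ((1 - y) / (1 - x)) \<le> (1 - y) / (1 - x) - 1"
    using assms by (intro ln_le_minus_one) simp
  also have "\<dots> = - (y - x) - (y - x) * x / (1 - x)" using assms by (simp add: field_simps)
  also have "\<dots> \<le> - (y - x)" using assms by simp
  finally show ?thesis using assms by (simp add: psi_def ln_div)
qed

lemma exp_neg_psi: "x < 1 \<Longrightarrow> exp (- psi x) = (1 - x) * exp x"
  by (simp add: psi_def exp_add)

definition tail :: "(int \<Rightarrow> real) \<Rightarrow> real \<Rightarrow> real \<Rightarrow> real" where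
  "tail a R u = (\<Sum>\<^sub>\<infinity>n\<in>{n. R < \<bar>a n\<bar>}. psi (u / a n))"

locale sparse_zeros =
  fixes a :: "int \<Rightarrow> real"
  assumes finite_le: "finite {n. \<bar>a n\<bar> \<le> C}"
    and summable: "(\<lambda>n. 1 / (a n)\<^sup>2) summable_on UNIV"
begin

lemma quotient_less_1:
  assumes "\<bar>u\<bar> \<le> R" "R < \<bar>a n\<bar>" shows "u / a n < 1"
proof -
  have "\<bar>u / a n\<bar> < 1" using assms by (auto simp: divide_less_eq_1)
  then show ?thesis by linarith
qed

lemma psi_quotient_nonneg: "\<bar>u\<bar> \<le> R \<Longrightarrow> R < \<bar>a n\<bar> \<Longrightarrow> 0 \<le> psi (u / a n)"
  by (intro psi_nonneg quotient_less_1)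

lemma psi_quotient_le: "2 * \<bar>u\<bar> \<le> R \<Longrightarrow> R < \<bar>a n\<bar> \<Longrightarrow> psi (u / a n) \<le> 2 * u\<^sup>2 * (1 / (a n)\<^sup>2)"
  using psi_le_square[of "u / a n"] by (auto simp: abs_divide power_divide field_simps)

lemma summable_psi_far:
  assumes "2 * \<bar>u\<bar> \<le> R"
  shows "(\<lambda>n. psi (u / a n)) summable_on {n. R < \<bar>a n\<bar>}"
proof (rule summable_on_comparison_test)
  show "(\<lambda>n. 2 * u\<^sup>2 * (1 / (a n)\<^sup>2)) summable_on {n. R < \<bar>a n\<bar>}"
    by (intro summable_on_cmult_right summable_on_subset[OF summable]) auto
qed (use assms psi_quotient_le[of u R] psi_quotient_nonneg[of u R] in auto)

lemma summable_psi:
  assumes "\<bar>u\<bar> \<le> R"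
  shows "(\<lambda>n. psi (u / a n)) summable_on {n. R < \<bar>a n\<bar>}"
proof -
  have "{n. R < \<bar>a n\<bar>} = {n. R < \<bar>a n\<bar> \<and> \<bar>a n\<bar> \<le> 2 * R} \<union> {n. 2 * R < \<bar>a n\<bar>}"
    using assms by auto
  moreover have "finite {n. R < \<bar>a n\<bar> \<and> \<bar>a n\<bar> \<le> 2 * R}"
    by (rule finite_subset[OF _ finite_le[of "2 * R"]]) auto
  then have "(\<lambda>n. psi (u / a n)) summable_on ({n. R < \<bar>a n\<bar> \<and> \<bar>a n\<bar> \<le> 2 * R} \<union> {n. 2 * R < \<bar>a n\<bar>})"
    by (intro summable_on_Un_disjoint summable_on_finite summable_psi_far) (use assms in auto)
  ultimately show ?thesis by simp
qed

lemma tail_nonneg: "\<bar>u\<bar> \<le> R \<Longrightarrow> 0 \<le> tail a R u"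
  unfolding tail_def by (rule infsum_nonneg) (auto intro: psi_quotient_nonneg)

text \<open>Links unordered sums to limits over the windows \<open>\<bar>a n\<bar> < S\<close>, the
  order of summation in which the weight is given.\<close>

lemma filterlim_window:
  "filterlim (\<lambda>S. {n. R < \<bar>a n\<bar> \<and> \<bar>a n\<bar> < S}) (finite_subsets_at_top {n. R < \<bar>a n\<bar>}) at_top"
  unfolding filterlim_finite_subsets_at_top
proof safe
  fix X assume X: "finite X" "X \<subseteq> {n. R < \<bar>a n\<bar>}"
  have "\<forall>\<^sub>F S in at_top. \<forall>n\<in>X. \<bar>a n\<bar> < S"
    using X by (simp add: eventually_ball_finite eventually_gt_at_top)
  then show "\<forall>\<^sub>F S in at_top. finite {n. R < \<bar>a n\<bar> \<and> \<bar>a n\<bar> < S} \<and>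
      X \<subseteq> {n. R < \<bar>a n\<bar> \<and> \<bar>a n\<bar> < S} \<and> {n. R < \<bar>a n\<bar> \<and> \<bar>a n\<bar> < S} \<subseteq> {n. R < \<bar>a n\<bar>}"
  proof eventually_elim
    case (elim S)
    have "finite {n. R < \<bar>a n\<bar> \<and> \<bar>a n\<bar> < S}"
      by (rule finite_subset[OF _ finite_le[of S]]) auto
    then show ?case using elim X by auto
  qed
qed

lemma tendsto_tail:
  assumes "\<bar>u\<bar> \<le> R"
  shows "((\<lambda>S. \<Sum>n\<in>{n. R < \<bar>a n\<bar> \<and> \<bar>a n\<bar> < S}. psi (u / a n)) \<longlongrightarrow> tail a R u) at_top"
  unfolding tail_def
  by (rule filterlim_compose[OF infsum_tendsto[OF summable_psi[OF assms]] filterlim_window])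

lemma tail_sum_tendsto_0:
  "((\<lambda>R. \<Sum>\<^sub>\<infinity>n\<in>{n. R < \<bar>a n\<bar>}. 1 / (a n)\<^sup>2) \<longlongrightarrow> 0) at_top"
proof -
  let ?f = "\<lambda>n. 1 / (a n)\<^sup>2"
  have "filterlim (\<lambda>R. {n. \<bar>a n\<bar> \<le> R}) (finite_subsets_at_top UNIV) at_top"
    unfolding filterlim_finite_subsets_at_top
  proof safe
    fix X :: "int set" assume X: "finite X"
    have "\<forall>\<^sub>F S in at_top. \<forall>n\<in>X. \<bar>a n\<bar> \<le> S"
      using X by (simp add: eventually_ball_finite eventually_ge_at_top)
    then show "\<forall>\<^sub>F S in at_top. finite {n. \<bar>a n\<bar> \<le> S} \<and> X \<subseteq> {n. \<bar>a n\<bar> \<le> S} \<and> {n. \<bar>a n\<bar> \<le> S} \<subseteq> UNIV"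
      by eventually_elim (use finite_le in auto)
  qed
  from filterlim_compose[OF infsum_tendsto[OF summable] this]
  have "((\<lambda>R. infsum ?f UNIV - (\<Sum>n\<in>{n. \<bar>a n\<bar> \<le> R}. ?f n)) \<longlongrightarrow> infsum ?f UNIV - infsum ?f UNIV) at_top"
    by (intro tendsto_intros)
  moreover have "infsum ?f UNIV - (\<Sum>n\<in>{n. \<bar>a n\<bar> \<le> R}. ?f n) = infsum ?f {n. R < \<bar>a n\<bar>}" for R
  proof -
    have "infsum ?f (UNIV - {n. \<bar>a n\<bar> \<le> R}) = infsum ?f UNIV - infsum ?f {n. \<bar>a n\<bar> \<le> R}"
      by (rule infsum_Diff) (use summable finite_le in auto)
    moreover have "UNIV - {n. \<bar>a n\<bar> \<le> R} = {n. R < \<bar>a n\<bar>}" by auto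
    ultimately show ?thesis using finite_le by simp
  qed
  ultimately show ?thesis by simp
qed

text \<open>Once \<open>R\<close> is at least \<open>2 * A\<close> all arguments of
  \<open>psi\<close> are at most 1/2, where it is bounded quadratically. This takes care of
  evaluation points so close to the origin that a fixed displacement is not small relative to
  them.\<close>

lemma tail_eventually_le:
  assumes "0 < \<epsilon>"
  shows "\<forall>\<^sub>F R in at_top. \<forall>u. \<bar>u\<bar> \<le> A \<longrightarrow> tail a R u \<le> \<epsilon>"
proof -
  have "((\<lambda>R. 2 * A\<^sup>2 * (\<Sum>\<^sub>\<infinity>n\<in>{n. R < \<bar>a n\<bar>}. 1 / (a n)\<^sup>2)) \<longlongrightarrow> 2 * A\<^sup>2 * 0) at_top"
    by (intro tendsto_intros tail_sum_tendsto_0)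
  then have "\<forall>\<^sub>F R in at_top. 2 * A\<^sup>2 * (\<Sum>\<^sub>\<infinity>n\<in>{n. R < \<bar>a n\<bar>}. 1 / (a n)\<^sup>2) < \<epsilon>"
    using assms by (intro order_tendstoD) auto
  then show ?thesis using eventually_ge_at_top[of "2 * A"]
  proof eventually_elim
    case (elim R)
    show ?case
    proof safe
      fix u assume u: "\<bar>u\<bar> \<le> A"
      have u2: "u\<^sup>2 \<le> A\<^sup>2" using u by (simp add: abs_le_square_iff[symmetric])
      have "tail a R u \<le> (\<Sum>\<^sub>\<infinity>n\<in>{n. R < \<bar>a n\<bar>}. 2 * A\<^sup>2 * (1 / (a n)\<^sup>2))"
        unfolding tail_def
      proof (rule infsum_mono)
        fix n assume "n \<in> {n. R < \<bar>a n\<bar>}"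
        then have "psi (u / a n) \<le> 2 * u\<^sup>2 * (1 / (a n)\<^sup>2)"
          using u elim by (intro psi_quotient_le) auto
        also have "\<dots> \<le> 2 * A\<^sup>2 * (1 / (a n)\<^sup>2)" using u2 by (intro mult_right_mono) auto
        finally show "psi (u / a n) \<le> 2 * A\<^sup>2 * (1 / (a n)\<^sup>2)" .
      next
        show "(\<lambda>n. psi (u / a n)) summable_on {n. R < \<bar>a n\<bar>}"
          using u elim by (intro summable_psi_far) auto
        show "(\<lambda>n. 2 * A\<^sup>2 * (1 / (a n)\<^sup>2)) summable_on {n. R < \<bar>a n\<bar>}"
          by (intro summable_on_cmult_right summable_on_subset[OF summable]) auto
      qed
      also have "\<dots> = 2 * A\<^sup>2 * (\<Sum>\<^sub>\<infinity>n\<in>{n. R < \<bar>a n\<bar>}. 1 / (a n)\<^sup>2)"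
        by (rule infsum_cmult_right) (auto intro: summable_on_subset[OF summable])
      finally show "tail a R u \<le> \<epsilon>" using elim by simp
    qed
  qed
qed

end

text \<open>Matched terms are compared by monotonicity of \<open>psi\<close>; indices of
  \<open>b\<close> outside the image of \<open>g\<close> contribute nonnegative terms, so
  \<open>g\<close> only has to be injective.\<close>

lemma tail_le_tail:
  assumes "sparse_zeros a" "sparse_zeros b" and u: "\<bar>u\<bar> \<le> R" and v: "\<bar>v\<bar> \<le> S"
    and inj: "inj g" and g: "\<And>n. R < \<bar>a n\<bar> \<Longrightarrow> S < \<bar>b (g n)\<bar>"
    and le: "\<And>n. R < \<bar>a n\<bar> \<Longrightarrow> 0 \<le> (v / b (g n) - u / a n) * (u / a n)"
  shows "tail a R u \<le> tail b S v"
proof -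
  interpret A: sparse_zeros a by fact
  interpret B: sparse_zeros b by fact
  let ?I = "{n. R < \<bar>a n\<bar>}"
  have gi: "g ` ?I \<subseteq> {n. S < \<bar>b n\<bar>}" using g by auto
  have sB: "(\<lambda>n. psi (v / b n)) summable_on (g ` ?I)"
    by (rule summable_on_subset[OF B.summable_psi[OF v] gi])
  have inj': "inj_on g ?I" using inj by (rule inj_on_subset) auto
  have "tail a R u \<le> infsum ((\<lambda>n. psi (v / b n)) \<circ> g) ?I"
    unfolding tail_def
  proof (rule infsum_mono)
    fix n assume "n \<in> ?I"
    then have n: "R < \<bar>a n\<bar>" by simp
    show "psi (u / a n) \<le> ((\<lambda>n. psi (v / b n)) \<circ> g) n"
      using A.quotient_less_1[OF u n] B.quotient_less_1[OF v g[OF n]] le[OF n]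
      by (auto intro!: psi_mono)
  qed (use sB A.summable_psi[OF u] summable_on_reindex[OF inj', of "\<lambda>n. psi (v / b n)"] in auto)
  also have "\<dots> = infsum (\<lambda>n. psi (v / b n)) (g ` ?I)"
    by (rule infsum_reindex[OF inj', symmetric])
  also have "\<dots> \<le> tail b S v"
    unfolding tail_def
    by (rule infsum_mono2[OF sB B.summable_psi[OF v] gi]) (use v in \<open>auto intro: B.psi_quotient_nonneg\<close>)
  finally show ?thesis .
qed

section \<open>The integers as model sequence, and Euler's product for sinc\<close>

lemma summable_on_inverse_squares_int: "(\<lambda>n::int. 1 / (of_int n :: real)\<^sup>2) summable_on UNIV"
proof -
  have "summable (\<lambda>n::nat. 1 / (real n)\<^sup>2)"
    using inverse_power_summable[of 2, where 'a = real] by (simp add: inverse_eq_divide)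
  then have s: "(\<lambda>n::nat. 1 / (real n)\<^sup>2) summable_on UNIV"
    by (intro summable_nonneg_imp_summable_on) auto
  have "(\<lambda>n::int. 1 / (of_int n :: real)\<^sup>2) summable_on (range int)"
    by (subst summable_on_reindex) (use s in \<open>auto simp: o_def\<close>)
  moreover have "(\<lambda>n::int. 1 / (of_int n :: real)\<^sup>2) summable_on (range (\<lambda>n. - int n))"
    by (subst summable_on_reindex) (use s in \<open>auto simp: o_def inj_on_def\<close>)
  moreover have "UNIV = range int \<union> range (\<lambda>n. - int n)"
    by (auto simp: image_iff) (metis int_cases2)
  ultimately show ?thesis by (metis summable_on_union)
qed

lemma finite_abs_int_le: "finite {n::int. \<bar>of_int n :: real\<bar> \<le> C}"
proof (rule finite_subset)
  show "{n::int. \<bar>of_int n :: real\<bar> \<le> C} \<subseteq> {-\<lceil>C\<rceil>..\<lceil>C\<rceil>}"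
    by (auto; linarith)
qed auto

text \<open>The index 0 does no harm: its term in the summability condition is
  \<open>1 / 0 = 0\<close>, and it lies outside every tail with \<open>R >= 0\<close>.\<close>

interpretation ints: sparse_zeros of_int
  by standard (use summable_on_inverse_squares_int finite_abs_int_le in auto)

lemma tail_int_minus:
  assumes "\<bar>u\<bar> \<le> R" shows "tail of_int R (- u) = tail of_int R u"
proof (rule antisym)
  show "tail of_int R (- u) \<le> tail of_int R u"
    by (rule tail_le_tail[where g = uminus]) (use assms ints.sparse_zeros_axioms in auto)
  show "tail of_int R u \<le> tail of_int R (- u)"
    by (rule tail_le_tail[where g = uminus]) (use assms ints.sparse_zeros_axioms in auto)
qed

text \<open>Pairing \<open>j\<close> with \<open>-j\<close> cancels the exponential convergence
  factors and leaves the factors of the sine product.\<close>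

lemma tendsto_prod_tail_int:
  assumes "\<bar>s\<bar> \<le> real M"
  shows "(\<lambda>K. \<Prod>j=M+1..K. 1 - s\<^sup>2 / (real j)\<^sup>2) \<longlonglongrightarrow> exp (- tail of_int M s)"
proof -
  \<comment> \<open>\<open>Suc K\<close> because the windows are strict at their upper end.\<close>
  have "filterlim (\<lambda>K. real (Suc K)) at_top sequentially"
    using filterlim_real_sequentially filterlim_sequentially_Suc by blast
  then have "(\<lambda>K. exp (- (\<Sum>n\<in>{n. real M < \<bar>of_int n\<bar> \<and> \<bar>of_int n\<bar> < real (Suc K)}. psi (s / of_int n)))) \<longlonglongrightarrow> exp (- tail of_int M s)"
    by (intro tendsto_intros filterlim_compose[OF ints.tendsto_tail[OF assms]])
  moreover have "exp (- (\<Sum>n\<in>{n. real M < \<bar>of_int n\<bar> \<and> \<bar>of_int n\<bar> < real (Suc K)}. psi (s / of_int n)))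
      = (\<Prod>j=M+1..K. 1 - s\<^sup>2 / (real j)\<^sup>2)" for K
  proof -
    have set: "{n. real M < \<bar>of_int n\<bar> \<and> \<bar>of_int n\<bar> < real (Suc K)} = int ` {M+1..K} \<union> (\<lambda>j. - int j) ` {M+1..K}"
    proof (intro set_eqI iffI)
      fix n :: int assume n: "n \<in> {n. real M < \<bar>of_int n\<bar> \<and> \<bar>of_int n\<bar> < real (Suc K)}"
      then have "nat \<bar>n\<bar> \<in> {M+1..K}" by (auto simp: abs_if split: if_splits)
      moreover have "n = int (nat \<bar>n\<bar>) \<or> n = - int (nat \<bar>n\<bar>)" by auto
      ultimately show "n \<in> int ` {M+1..K} \<union> (\<lambda>j. - int j) ` {M+1..K}" by blast
    qed auto
    have "(\<Sum>n\<in>{n. real M < \<bar>of_int n\<bar> \<and> \<bar>of_int n\<bar> < real (Suc K)}. psi (s / of_int n))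
       = (\<Sum>n\<in>int ` {M+1..K}. psi (s / of_int n)) + (\<Sum>n\<in>(\<lambda>j. - int j) ` {M+1..K}. psi (s / of_int n))"
      unfolding set by (rule sum.union_disjoint) auto
    also have "\<dots> = (\<Sum>j=M+1..K. psi (s / real j) + psi (- s / real j))"
      by (simp add: sum.reindex inj_on_def sum.distrib)
    also have "exp (- \<dots>) = exp (\<Sum>j=M+1..K. - (psi (s / real j) + psi (- s / real j)))"
      by (simp only: sum_negf)
    also have "\<dots> = (\<Prod>j=M+1..K. exp (- (psi (s / real j) + psi (- s / real j))))"
      by (rule exp_sum) simp
    also have "\<dots> = (\<Prod>j=M+1..K. 1 - s\<^sup>2 / (real j)\<^sup>2)"
    proof (rule prod.cong[OF refl])
      fix j assume j: "j \<in> {M+1..K}"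
      have "\<bar>s / real j\<bar> < 1" using assms j by auto
      then have "s / real j < 1" "- s / real j < 1" by linarith+
      then have "exp (- psi (s / real j)) * exp (- psi (- s / real j))
          = (1 - s / real j) * (1 + s / real j) * (exp (s / real j) * exp (- (s / real j)))"
        by (simp add: exp_neg_psi del: divide_less_eq_1)
      also have "exp (s / real j) * exp (- (s / real j)) = 1" by (simp flip: exp_add)
      also have "(1 - s / real j) * (1 + s / real j) * 1 = 1 - s\<^sup>2 / (real j)\<^sup>2"
        by (simp add: algebra_simps power2_eq_square)
      finally show "exp (- (psi (s / real j) + psi (- s / real j))) = 1 - s\<^sup>2 / (real j)\<^sup>2"
        by (simp only: minus_add_distrib exp_add)
    qed
    finally show ?thesis .
  qed
  ultimately show ?thesis by simp
qed

lemma sinc_eq_prod_tail: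
  assumes "\<bar>s\<bar> \<le> real M"
  shows "sinc s = (\<Prod>j=1..M. 1 - s\<^sup>2 / (real j)\<^sup>2) * exp (- tail of_int M s)"
proof -
  have "(\<lambda>K. (\<Prod>j=1..K. 1 - s\<^sup>2 / (real j)\<^sup>2)) \<longlonglongrightarrow> sinc s"
    using sin_product_formula_real'[of s] by (cases "s = 0") (auto simp: sinc_def)
  moreover have "(\<lambda>K. (\<Prod>j=1..K. 1 - s\<^sup>2 / (real j)\<^sup>2))
     \<longlonglongrightarrow> (\<Prod>j=1..M. 1 - s\<^sup>2 / (real j)\<^sup>2) * exp (- tail of_int M s)"
  proof (rule Lim_transform_eventually)
    show "(\<lambda>K. (\<Prod>j=1..M. 1 - s\<^sup>2 / (real j)\<^sup>2) * (\<Prod>j=M+1..K. 1 - s\<^sup>2 / (real j)\<^sup>2))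
     \<longlonglongrightarrow> (\<Prod>j=1..M. 1 - s\<^sup>2 / (real j)\<^sup>2) * exp (- tail of_int M s)"
      by (intro tendsto_intros tendsto_prod_tail_int assms)
    show "\<forall>\<^sub>F K in sequentially. (\<Prod>j=1..M. 1 - s\<^sup>2 / (real j)\<^sup>2) * (\<Prod>j=M+1..K. 1 - s\<^sup>2 / (real j)\<^sup>2)
       = (\<Prod>j=1..K. 1 - s\<^sup>2 / (real j)\<^sup>2)"
      using eventually_ge_at_top[of M]
    proof eventually_elim
      case (elim K)
      have "{1..K} = {1..M} \<union> {M+1..K}" using elim by auto
      then show ?case by (simp add: prod.union_disjoint)
    qed
  qed
  ultimately show ?thesis using LIMSEQ_unique by blast
qed

text \<open>Each increase of \<open>k\<close> trades a factor \<open>M - k\<close> for the larger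
  \<open>M + k + 1\<close>.\<close>

lemma fact_square_le: "k \<le> M \<Longrightarrow> (fact M :: real)\<^sup>2 \<le> fact (M + k) * fact (M - k)"
proof (induction k)
  case (Suc k)
  define d where "d = M - Suc k"
  have d: "M - k = Suc d" "d \<le> M + k" using Suc.prems by (auto simp: d_def)
  have "(fact M :: real)\<^sup>2 \<le> fact (M + k) * fact (M - k)" using Suc by simp
  also have "\<dots> = fact (M + k) * fact d * real (Suc d)" unfolding d(1) by simp
  also have "\<dots> \<le> fact (M + k) * fact d * real (Suc (M + k))"
    using d(2) by (intro mult_left_mono) auto
  also have "\<dots> = fact (M + Suc k) * fact (M - Suc k)" by (simp add: d_def)
  finally show ?case .
qed (simp add: power2_eq_square)

text \<open>The ratio at \<open>M\<close> is the ratio at a larger \<open>K\<close> times the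
  product of \<open>1 - k^2 / j^2\<close> over \<open>M < j <= K\<close>, and every such ratio is at
  most 1. A separate argument is called for because at nonzero integers the cut Euler product for
  sinc only says \<open>0 = 0\<close>.\<close>

lemma central_factorial_ratio_le:
  assumes "k \<le> M"
  shows "(fact M)\<^sup>2 / (fact (M + k) * fact (M - k)) \<le> exp (- tail of_int M (real k))"
proof (rule tendsto_lowerbound)
  show "(\<lambda>K. \<Prod>j=M+1..K. 1 - (real k)\<^sup>2 / (real j)\<^sup>2) \<longlonglongrightarrow> exp (- tail of_int M (real k))"
    by (rule tendsto_prod_tail_int) (use assms in auto)
  show "\<forall>\<^sub>F K in sequentially. (fact M)\<^sup>2 / (fact (M + k) * fact (M - k)) \<le> (\<Prod>j=M+1..K. 1 - (real k)\<^sup>2 / (real j)\<^sup>2)"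
    using eventually_ge_at_top[of M]
  proof eventually_elim
    case (elim K)
    let ?c = "\<lambda>K. (fact K)\<^sup>2 / (fact (K + k) * fact (K - k)) :: real"
    have "?c M = ?c K * (\<Prod>j=M+1..K. 1 - (real k)\<^sup>2 / (real j)\<^sup>2)"
      using elim
    proof (induction K rule: dec_induct)
      case (step K)
      have kK: "k \<le> K" using step assms by simp
      have e1: "1 - (real k)\<^sup>2 / (real (Suc K))\<^sup>2 = real (Suc K + k) * real (Suc K - k) / (real (Suc K))\<^sup>2"
      proof -
        have "real (Suc K - k) = real (Suc K) - real k" using kK by (simp add: of_nat_diff)
        moreover have "1 - y\<^sup>2 / x\<^sup>2 = (x + y) * (x - y) / x\<^sup>2" if "x \<noteq> 0" for x y :: real
          using that by (simp add: field_simps power2_eq_square)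
        ultimately show ?thesis by (simp del: of_nat_Suc)
      qed
      have f1: "fact (Suc K - k) = real (Suc K - k) * fact (K - k)"
        using kK by (simp add: Suc_diff_le)
      have f2: "fact (Suc K + k) = real (Suc K + k) * fact (K + k)" by simp
      have f3: "(fact (Suc K) :: real)\<^sup>2 = (real (Suc K))\<^sup>2 * (fact K)\<^sup>2" by (simp add: power_mult_distrib)
      have "real (Suc K - k) \<noteq> 0" "real (Suc K + k) \<noteq> 0" "real (Suc K) \<noteq> 0" using kK by auto
      then have "?c (Suc K) * (1 - (real k)\<^sup>2 / (real (Suc K))\<^sup>2) = ?c K"
        unfolding e1 f1 f2 f3 by (simp add: divide_simps del: of_nat_Suc of_nat_add)
      moreover have "(\<Prod>j=M+1..Suc K. 1 - (real k)\<^sup>2 / (real j)\<^sup>2) =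
          (1 - (real k)\<^sup>2 / (real (Suc K))\<^sup>2) * (\<Prod>j=M+1..K. 1 - (real k)\<^sup>2 / (real j)\<^sup>2)"
        using step by (simp add: mult.commute)
      ultimately show ?case using step(3) by (simp only: mult.assoc[symmetric])
    qed simp
    also have "\<dots> \<le> 1 * (\<Prod>j=M+1..K. 1 - (real k)\<^sup>2 / (real j)\<^sup>2)"
    proof (rule mult_right_mono)
      show "?c K \<le> 1" using fact_square_le[of k K] elim assms by (simp add: divide_le_eq_1)
      show "0 \<le> (\<Prod>j=M+1..K. 1 - (real k)\<^sup>2 / (real j)\<^sup>2)"
        using assms by (intro prod_nonneg) (auto simp: divide_le_eq_1 power_mono)
    qed
    finally show ?case by simp
  qed
qed simp

subsection \<open>Interpolation at the integers\<close>

definition node_basis :: "nat \<Rightarrow> int \<Rightarrow> real \<Rightarrow> real" where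
  "node_basis M n x = (\<Prod>j\<in>{-int M..int M} - {n}. (x - of_int j) / (of_int n - of_int j))"

lemma lagrange_integers:
  fixes q :: "real poly"
  assumes "degree q \<le> 2 * M"
  shows "poly q x = (\<Sum>n=-int M..int M. poly q (of_int n) * node_basis M n x)"
proof -
  let ?I = "{-int M..int M}"
  define L where "L n = smult (\<Prod>j\<in>?I - {n}. 1 / (of_int n - of_int j)) (\<Prod>j\<in>?I - {n}. [:- of_int j, 1 :: real:])" for n :: int
  have polyL: "poly (L n) y = node_basis M n y" for n and y :: real
    by (simp add: L_def node_basis_def poly_prod prod.distrib[symmetric] divide_inverse mult.commute)
  have degL: "degree (L n) \<le> 2 * M" if "n \<in> ?I" for n
  proof -
    have "degree (\<Prod>j\<in>?I - {n}. [:- of_int j, 1 :: real:]) \<le> (\<Sum>j\<in>?I - {n}. degree [:- of_int j, 1 :: real:])"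
      using degree_prod_sum_le[of "?I - {n}" "\<lambda>j. [:- of_int j, 1 :: real:]"] by (simp add: o_def)
    also have "\<dots> = 2 * M" using that by simp
    finally show ?thesis unfolding L_def by (meson degree_smult_le le_trans)
  qed
  have "q = (\<Sum>n\<in>?I. smult (poly q (of_int n)) (L n))"
  proof (rule poly_eqI_degree)
    have card: "card (of_int ` ?I :: real set) = 2 * M + 1"
      by (subst card_image) (auto simp: inj_on_def)
    show "degree q < card (of_int ` ?I :: real set)" using assms card by simp
    have "degree (\<Sum>n\<in>?I. smult (poly q (of_int n)) (L n)) \<le> 2 * M"
      by (rule degree_sum_le) (blast intro: order.trans[OF degree_smult_le degL] finite_atLeastAtMost_int)+
    then show "degree (\<Sum>n\<in>?I. smult (poly q (of_int n)) (L n)) < card (of_int ` ?I :: real set)"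
      using card by simp
    fix y :: real assume "y \<in> of_int ` ?I"
    then obtain m where m: "y = of_int m" "m \<in> ?I" by blast
    have "node_basis M n (of_int m) = (if n = m then 1 else 0)" for n
    proof (cases "n = m")
      case False
      then have "(\<Prod>j\<in>?I - {n}. (of_int m - of_int j) / (of_int n - of_int j)) = (0 :: real)"
        using m by (intro prod_zero) auto
      then show ?thesis using False by (simp add: node_basis_def)
    qed (auto simp: node_basis_def intro!: prod.neutral)
    then show "poly q y = poly (\<Sum>n\<in>?I. smult (poly q (of_int n)) (L n)) y"
      using m by (simp add: poly_sum polyL mult_delta_right)
  qed
  then have "poly q x = poly (\<Sum>n\<in>?I. smult (poly q (of_int n)) (L n)) x" by simp
  then show ?thesis by (simp add: poly_sum polyL)
qed

lemma prod_symmetric_integers: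
  "\<bar>\<Prod>j=-int M..int M. x - of_int j\<bar> = \<bar>x\<bar> * (fact M)\<^sup>2 * \<bar>\<Prod>j=1..M. 1 - x\<^sup>2 / (real j)\<^sup>2\<bar>"
proof (induction M)
  case (Suc M)
  have set: "{-int (Suc M)..int (Suc M)} = insert (int (Suc M)) (insert (- int (Suc M)) {-int M..int M})"
    by auto
  have e: "(x - real (Suc M)) * (x + real (Suc M)) = - ((real (Suc M))\<^sup>2 * (1 - x\<^sup>2 / (real (Suc M))\<^sup>2))"
  proof -
    have "(x - c) * (x + c) = - (c\<^sup>2 * (1 - x\<^sup>2 / c\<^sup>2))" if "c \<noteq> 0" for c
      using that by (simp add: field_simps power2_eq_square)
    then show ?thesis by simp
  qed
  have "(\<Prod>j=-int (Suc M)..int (Suc M). x - of_int j) = (x - real (Suc M)) * (x + real (Suc M)) * (\<Prod>j=-int M..int M. x - of_int j)"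
    unfolding set by simp
  then have "\<bar>\<Prod>j=-int (Suc M)..int (Suc M). x - of_int j\<bar>
    = (real (Suc M))\<^sup>2 * \<bar>1 - x\<^sup>2 / (real (Suc M))\<^sup>2\<bar> * \<bar>\<Prod>j=-int M..int M. x - of_int j\<bar>"
    unfolding e by (simp add: abs_mult)
  then show ?case unfolding Suc.IH
    by (simp add: abs_mult power_mult_distrib mult_ac)
qed simp

lemma prod_node_differences:
  assumes "\<bar>n\<bar> \<le> int M"
  shows "\<bar>\<Prod>j\<in>{-int M..int M} - {n}. of_int n - of_int j :: real\<bar> = fact (M + nat \<bar>n\<bar>) * fact (M - nat \<bar>n\<bar>)"
proof -
  have set: "{-int M..int M} - {n} = {-int M..n - 1} \<union> {n + 1..int M}" using assms by auto
  have "(\<Prod>j\<in>{-int M..int M} - {n}. of_int n - of_int j :: real) =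
     (\<Prod>j=-int M..n - 1. of_int n - of_int j) * (\<Prod>j=n + 1..int M. of_int n - of_int j)"
    unfolding set by (rule prod.union_disjoint) auto
  then have "\<bar>\<Prod>j\<in>{-int M..int M} - {n}. of_int n - of_int j :: real\<bar> =
     (\<Prod>j=-int M..n - 1. \<bar>of_int n - of_int j\<bar>) * (\<Prod>j=n + 1..int M. \<bar>of_int n - of_int j\<bar>)"
    by (simp add: abs_mult abs_prod)
  also have "(\<Prod>j=-int M..n - 1. \<bar>of_int n - of_int j :: real\<bar>) = fact (nat (int M + n))"
    unfolding fact_prod of_nat_prod
    by (rule prod.reindex_bij_witness[where i = "\<lambda>i. n - int i" and j = "\<lambda>j. nat (n - j)"]) (use assms in auto)
  also have "(\<Prod>j=n + 1..int M. \<bar>of_int n - of_int j :: real\<bar>) = fact (nat (int M - n))"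
    unfolding fact_prod of_nat_prod
    by (rule prod.reindex_bij_witness[where i = "\<lambda>i. n + int i" and j = "\<lambda>j. nat (j - n)"]) (use assms in auto)
  also have "fact (nat (int M + n)) * fact (nat (int M - n)) = (fact (M + nat \<bar>n\<bar>) * fact (M - nat \<bar>n\<bar>) :: real)"
  proof (cases "0 \<le> n")
    case True
    then have "nat (int M + n) = M + nat \<bar>n\<bar>" "nat (int M - n) = M - nat \<bar>n\<bar>" by auto
    then show ?thesis by simp
  next
    case False
    then have "nat (int M + n) = M - nat \<bar>n\<bar>" "nat (int M - n) = M + nat \<bar>n\<bar>" using assms by auto
    then show ?thesis by (simp add: mult.commute)
  qed
  finally show ?thesis .
qed

text \<open>The numerator with the factor at \<open>n\<close> restored is Euler's product cut at
  \<open>M\<close>, that is sinc times \<open>exp (tail of_int M x)\<close>; removing the factor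
  again shifts the sinc, since \<open>\<bar>sin\<bar>\<close> is periodic. The denominator is a
  product of two factorials. The factor \<open>exp (- tail of_int M n)\<close> is what has to
  compensate the division by \<open>outer\<close> at the node.\<close>

lemma abs_node_basis_le:
  assumes x: "x \<notin> \<int>" "\<bar>x\<bar> \<le> real M" and n: "\<bar>n\<bar> \<le> int M"
  shows "\<bar>node_basis M n x\<bar> \<le> \<bar>sinc (x - of_int n)\<bar> * exp (tail of_int M x - tail of_int M (of_int n))"
proof -
  let ?I = "{-int M..int M}"
  define k where "k = nat \<bar>n\<bar>"
  have k: "k \<le> M" "real k = \<bar>of_int n\<bar>" using n by (auto simp: k_def)
  have nz: "x - of_int j \<noteq> 0" for j using x(1) by (metis Ints_of_int eq_iff_diff_eq_0)
  have x0: "x \<noteq> 0" using nz[of 0] by simp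
  have "(x - of_int n) * (\<Prod>j\<in>?I - {n}. x - of_int j) = (\<Prod>j\<in>?I. x - of_int j)"
    using n by (intro prod.remove[symmetric]) auto
  then have "\<bar>x - of_int n\<bar> * \<bar>\<Prod>j\<in>?I - {n}. x - of_int j\<bar> = \<bar>x\<bar> * (fact M)\<^sup>2 * \<bar>\<Prod>j=1..M. 1 - x\<^sup>2 / (real j)\<^sup>2\<bar>"
    by (metis abs_mult prod_symmetric_integers)
  also have "(\<Prod>j=1..M. 1 - x\<^sup>2 / (real j)\<^sup>2) = sinc x * exp (tail of_int M x)"
    using sinc_eq_prod_tail[OF x(2)] by (simp add: exp_minus field_simps)
  finally have P: "\<bar>\<Prod>j\<in>?I - {n}. x - of_int j\<bar> = (fact M)\<^sup>2 * (\<bar>x * sinc x\<bar> / \<bar>x - of_int n\<bar>) * exp (tail of_int M x)"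
    using nz[of n] by (simp add: abs_mult field_simps)
  have "x * sinc x = sin (pi * x) / pi" using x0 by (simp add: sinc_def)
  moreover have "\<bar>sin (pi * (x - of_int n))\<bar> = \<bar>sin (pi * x)\<bar>"
    using abs_sin_shift[of "pi * x" "-n"] by (simp add: algebra_simps)
  ultimately have S: "\<bar>x * sinc x\<bar> / \<bar>x - of_int n\<bar> = \<bar>sinc (x - of_int n)\<bar>"
    using nz[of n] by (simp add: sinc_def abs_mult)
  have "\<bar>node_basis M n x\<bar> = \<bar>\<Prod>j\<in>?I - {n}. x - of_int j\<bar> / (fact (M + k) * fact (M - k))"
    unfolding node_basis_def k_def prod_node_differences[OF n, symmetric] prod_dividef by simp
  also have "\<dots> = \<bar>sinc (x - of_int n)\<bar> * exp (tail of_int M x) * ((fact M)\<^sup>2 / (fact (M + k) * fact (M - k)))"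
    unfolding P S by simp
  also have "\<dots> \<le> \<bar>sinc (x - of_int n)\<bar> * exp (tail of_int M x) * exp (- tail of_int M (real k))"
    by (intro mult_left_mono central_factorial_ratio_le k) auto
  also have "tail of_int M (real k) = tail of_int M (of_int n)"
    using tail_int_minus[of "of_int n" M] n k by (cases "0 \<le> n") auto
  finally show ?thesis by (simp add: exp_diff exp_minus field_simps)
qed

subsection \<open>Comparison of the zeros with the integers\<close>

text \<open>Rounding is towards 0 on both half-lines, so that the image never exceeds
  \<open>\<kappa> * \<bar>j\<bar>\<close> in modulus while signs are kept.\<close>

definition stretch :: "real \<Rightarrow> int \<Rightarrow> int" where
  "stretch \<kappa> j = sgn j * \<lfloor>\<kappa> * \<bar>of_int j\<bar>\<rfloor>"

lemma abs_stretch: "1 \<le> \<kappa> \<Longrightarrow> \<bar>stretch \<kappa> j\<bar> = \<lfloor>\<kappa> * \<bar>of_int j\<bar>\<rfloor>"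
  by (cases "j = 0") (auto simp: stretch_def abs_mult abs_sgn_eq)

lemma abs_stretch_le: "1 \<le> \<kappa> \<Longrightarrow> \<bar>of_int (stretch \<kappa> j)\<bar> \<le> \<kappa> * \<bar>of_int j\<bar>"
  by (metis abs_stretch of_int_abs of_int_floor_le)

lemma abs_stretch_gt: "1 \<le> \<kappa> \<Longrightarrow> \<kappa> * \<bar>of_int j\<bar> - 1 < \<bar>of_int (stretch \<kappa> j)\<bar>"
  by (metis abs_stretch of_int_abs diff_less_eq real_of_int_floor_add_one_gt)

lemma stretch_mult_nonneg: "1 \<le> \<kappa> \<Longrightarrow> 0 \<le> j * stretch \<kappa> j"
  using abs_sgn[of j] by (simp add: stretch_def flip: mult.assoc)

lemma stretch_nonzero:
  assumes "1 \<le> \<kappa>" "j \<noteq> 0" shows "0 < j * stretch \<kappa> j"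
proof -
  have "1 \<le> \<kappa> * \<bar>of_int j\<bar>" using mult_mono[of 1 \<kappa> 1 "\<bar>of_int j :: real\<bar>"] assms by linarith
  then have "1 \<le> \<bar>stretch \<kappa> j\<bar>" using abs_stretch[OF assms(1)] by (simp add: le_floor_iff)
  then show ?thesis using stretch_mult_nonneg[OF assms(1), of j] assms(2) by (auto simp: order_le_less)
qed

lemma inj_stretch:
  assumes "1 \<le> \<kappa>" shows "inj (stretch \<kappa>)"
proof (rule injI)
  fix i j assume eq: "stretch \<kappa> i = stretch \<kappa> j"
  have less: "\<lfloor>\<kappa> * of_int a\<rfloor> < \<lfloor>\<kappa> * of_int b\<rfloor>" if "a < b" for a b :: int
  proof -
    have "1 \<le> \<kappa> * (of_int b - of_int a)" using mult_mono[of 1 \<kappa> 1 "of_int b - of_int a :: real"] assms that by simp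
    then have "\<kappa> * of_int a + 1 \<le> \<kappa> * of_int b" by (simp add: algebra_simps)
    then have "\<lfloor>\<kappa> * of_int a + 1\<rfloor> \<le> \<lfloor>\<kappa> * of_int b\<rfloor>" by (rule floor_mono)
    then show ?thesis by simp
  qed
  have "\<lfloor>\<kappa> * of_int \<bar>i\<bar>\<rfloor> = \<lfloor>\<kappa> * of_int \<bar>j\<bar>\<rfloor>"
    using abs_stretch[OF assms, of i] abs_stretch[OF assms, of j] eq by simp
  then have "\<bar>i\<bar> = \<bar>j\<bar>" using less by (metis less_irrefl linorder_neqE)
  moreover have "i = 0 \<or> 0 < i * stretch \<kappa> i" "j = 0 \<or> 0 < j * stretch \<kappa> j"
    using stretch_nonzero[OF assms] by auto
  ultimately show "i = j" unfolding eq by (auto simp: zero_less_mult_iff abs_if split: if_splits)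
qed

text \<open>Brings an inequality between moduli into the product form in which
  \<open>tail_le_tail\<close> expects matched zeros.\<close>

lemma quotient_dominated:
  fixes u v a b :: real
  assumes "0 \<le> u * v" "0 < a * b" "\<bar>u\<bar> * \<bar>b\<bar> \<le> \<bar>v\<bar> * \<bar>a\<bar>"
  shows "0 \<le> (v / b - u / a) * (u / a)"
proof -
  have nz: "a \<noteq> 0" "b \<noteq> 0" using assms(2) by auto
  have "\<bar>u / a\<bar> \<le> \<bar>v / b\<bar>" using assms(3) nz by (simp add: field_simps)
  moreover have "0 \<le> (u / a) * (v / b)" using assms(1,2) by simp
  moreover have "0 \<le> (y - x) * x" if "\<bar>x\<bar> \<le> \<bar>y\<bar>" "0 \<le> x * y" for x y :: real
    using that by (auto simp: zero_le_mult_iff abs_if split: if_splits)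
  ultimately show ?thesis by blast
qed

locale almost_integers =
  fixes p :: "int \<Rightarrow> real"
  assumes mono: "strict_mono p" and neg: "p (- 1) < 0" and nonneg: "0 \<le> p 0"
    and sum_conv: "\<exists>L. ((\<lambda>S::real. \<Sum>n\<in>{n. 0 < \<bar>p n\<bar> \<and> \<bar>p n\<bar> < S}. 1 / p n) \<longlongrightarrow> L) at_top"
    and ratio_top: "((\<lambda>n. p n / of_int n) \<longlongrightarrow> 1) at_top"
    and ratio_bot: "((\<lambda>n. p n / of_int n) \<longlongrightarrow> 1) at_bot"
begin

lemma same_sign:
  assumes "n \<noteq> 0" shows "0 < p n * of_int n"
proof (cases "0 < n")
  case True
  then have "p 0 < p n" using mono by (simp add: strict_mono_def)
  then show ?thesis using nonneg True by simp
next
  case False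
  then have "p n \<le> p (-1)" using mono assms by (simp add: strict_mono_less_eq)
  then show ?thesis using neg False assms by (simp add: zero_less_mult_iff)
qed

lemma near_integers:
  assumes "0 < \<sigma>"
  obtains K where "0 < K" "\<And>n. K \<le> \<bar>n\<bar> \<Longrightarrow> \<bar>of_int n\<bar> \<le> (1 + \<sigma>) * \<bar>p n\<bar> \<and> \<bar>p n\<bar> \<le> (1 + \<sigma>) * \<bar>of_int n\<bar>"
proof -
  have l: "1 / (1 + \<sigma>) < 1" "1 < 1 + \<sigma>" using assms by auto
  from order_tendstoD(1)[OF ratio_top l(1)] order_tendstoD(2)[OF ratio_top l(2)]
  have "\<forall>\<^sub>F n in at_top. 1 / (1 + \<sigma>) < p n / of_int n \<and> p n / of_int n < 1 + \<sigma>"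
    by (rule eventually_conj)
  then obtain K1 where K1: "\<And>n. K1 \<le> n \<Longrightarrow> 1 / (1 + \<sigma>) < p n / of_int n \<and> p n / of_int n < 1 + \<sigma>"
    by (auto simp: eventually_at_top_linorder)
  from order_tendstoD(1)[OF ratio_bot l(1)] order_tendstoD(2)[OF ratio_bot l(2)]
  have "\<forall>\<^sub>F n in at_bot. 1 / (1 + \<sigma>) < p n / of_int n \<and> p n / of_int n < 1 + \<sigma>"
    by (rule eventually_conj)
  then obtain K2 where K2: "\<And>n. n \<le> K2 \<Longrightarrow> 1 / (1 + \<sigma>) < p n / of_int n \<and> p n / of_int n < 1 + \<sigma>"
    by (auto simp: eventually_at_bot_linorder)
  define K where "K = max 1 (max K1 (- K2))"
  have "\<bar>of_int n\<bar> \<le> (1 + \<sigma>) * \<bar>p n\<bar> \<and> \<bar>p n\<bar> \<le> (1 + \<sigma>) * \<bar>of_int n\<bar>" if n: "K \<le> \<bar>n\<bar>" for n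
  proof -
    have "K1 \<le> n \<or> n \<le> K2" using n by (auto simp: K_def)
    then have b: "1 / (1 + \<sigma>) < p n / of_int n" "p n / of_int n < 1 + \<sigma>" using K1 K2 by blast+
    have n0: "n \<noteq> 0" using n by (auto simp: K_def)
    have "0 < 1 / (1 + \<sigma>)" using assms by simp
    then have q: "p n / of_int n = \<bar>p n\<bar> / \<bar>of_int n\<bar>" using b(1) by (metis abs_divide abs_of_pos order.strict_trans)
    show ?thesis using b n0 assms unfolding q by (simp add: field_simps)
  qed
  moreover have "0 < K" by (simp add: K_def)
  ultimately show thesis using that by blast
qed

sublocale sparse_zeros p
proof
  obtain K where K: "0 < K" "\<And>n. K \<le> \<bar>n\<bar> \<Longrightarrow> \<bar>of_int n\<bar> \<le> (1 + 1) * \<bar>p n\<bar> \<and> \<bar>p n\<bar> \<le> (1 + 1) * \<bar>of_int n\<bar>"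
    using near_integers[of 1] by auto
  show "finite {n. \<bar>p n\<bar> \<le> C}" for C
  proof (rule finite_subset)
    show "{n. \<bar>p n\<bar> \<le> C} \<subseteq> {n. \<bar>of_int n :: real\<bar> \<le> max (of_int K) (2 * C)}"
    proof safe
      fix n assume n: "\<bar>p n\<bar> \<le> C"
      show "\<bar>of_int n :: real\<bar> \<le> max (of_int K) (2 * C)"
      proof (cases "K \<le> \<bar>n\<bar>")
        case True
        then have "\<bar>of_int n :: real\<bar> \<le> 2 * C" using K(2)[OF True] n by auto
        then show ?thesis by simp
      next
        case False
        then have "of_int \<bar>n\<bar> \<le> (of_int K :: real)" by linarith
        then show ?thesis by simp
      qed
    qed
  qed (rule finite_abs_int_le)
  have "(\<lambda>n. 1 / (p n)\<^sup>2) summable_on {n. K \<le> \<bar>n\<bar>}"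
  proof (rule summable_on_comparison_test)
    show "(\<lambda>n::int. 4 * (1 / (of_int n :: real)\<^sup>2)) summable_on {n. K \<le> \<bar>n\<bar>}"
      by (intro summable_on_cmult_right summable_on_subset[OF summable_on_inverse_squares_int]) auto
    fix n assume n: "n \<in> {n. K \<le> \<bar>n\<bar>}"
    then have "\<bar>of_int n\<bar> \<le> (1 + 1) * \<bar>p n\<bar>" and nz: "n \<noteq> 0" using K by auto
    then have le: "\<bar>of_int n\<bar> \<le> \<bar>2 * p n\<bar>" by simp
    from le have "(of_int n)\<^sup>2 \<le> (2 * p n)\<^sup>2" by (simp only: abs_le_square_iff)
    moreover have "p n \<noteq> 0" using same_sign[OF nz] by auto
    ultimately show "1 / (p n)\<^sup>2 \<le> 4 * (1 / (of_int n :: real)\<^sup>2)"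
      using nz by (simp add: field_simps)
  qed auto
  moreover have "(\<lambda>n. 1 / (p n)\<^sup>2) summable_on {n. \<bar>n\<bar> < K}"
    by (rule summable_on_finite) (rule finite_subset[of _ "{-K..K}"], auto)
  ultimately have "(\<lambda>n. 1 / (p n)\<^sup>2) summable_on ({n. K \<le> \<bar>n\<bar>} \<union> {n. \<bar>n\<bar> < K})"
    by (intro summable_on_Un_disjoint) auto
  moreover have "{n. K \<le> \<bar>n\<bar>} \<union> {n. \<bar>n\<bar> < K} = UNIV" by auto
  ultimately show "(\<lambda>n. 1 / (p n)\<^sup>2) summable_on UNIV" by simp
qed

text \<open>Far out, every zero of the tail has an index to which the ratio estimate
  applies.\<close>

lemma large_zero_large_index: "\<forall>\<^sub>F R in at_top. \<forall>j. R < \<bar>p j\<bar> \<longrightarrow> K \<le> \<bar>j\<bar>"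
proof -
  have "finite {j. \<bar>j\<bar> < K}" by (rule finite_subset[of _ "{-K..K}"]) auto
  then have "\<forall>\<^sub>F R in at_top. \<forall>j\<in>{j. \<bar>j\<bar> < K}. \<bar>p j\<bar> \<le> R"
    by (simp only: eventually_ball_finite_distrib) (simp add: eventually_ge_at_top)
  then show ?thesis by eventually_elim (auto simp: not_le[symmetric])
qed

text \<open>Each of the two comparisons needs an injection from one index set into the other that
  moves the zeros towards the origin no faster than the evaluation point; the slack
  \<open>(1 + \<sigma>)\<^sup>4\<close> in the node spacing is what makes rounding the stretched index affordable.\<close>

lemma tail_le_tail_int:
  assumes \<sigma>: "0 < \<sigma>" and \<epsilon>: "0 < \<epsilon>" and \<rho>: "\<rho> = 1 / (1 + \<sigma>) ^ 4"
  shows "\<forall>\<^sub>F R in at_top. \<forall>M::nat. \<forall>n::int. \<forall>u.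
      real M + 1 \<le> (1 + \<sigma>) * R \<longrightarrow> \<bar>n\<bar> \<le> int M \<longrightarrow> \<bar>u\<bar> \<le> R \<longrightarrow> \<bar>u - \<rho> * of_int n\<bar> \<le> \<rho> / 2 \<longrightarrow>
      tail p R u \<le> tail of_int M (of_int n) + \<epsilon>"
proof -
  obtain K where K: "0 < K" "\<And>n. K \<le> \<bar>n\<bar> \<Longrightarrow> \<bar>of_int n\<bar> \<le> (1 + \<sigma>) * \<bar>p n\<bar> \<and> \<bar>p n\<bar> \<le> (1 + \<sigma>) * \<bar>of_int n\<bar>"
    using near_integers[OF \<sigma>] by blast
  define c where "c = 1 + \<sigma>"
  have c: "1 < c" "c = 1 + \<sigma>" using \<sigma> by (auto simp: c_def)
  \<comment> \<open>Where the four factors \<open>c\<close> go: in \<open>\<kappa>\<close>, one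
    passes from \<open>M\<close> to \<open>R\<close> and one from \<open>\<bar>p j\<bar>\<close> to
    \<open>\<bar>j\<bar>\<close>; of the other two, one passes back from
    \<open>\<bar>j\<bar>\<close> to \<open>\<bar>p j\<bar>\<close> and one absorbs the half step by
    which \<open>u\<close> may miss its node.\<close>
  define \<kappa> where "\<kappa> = c\<^sup>2"
  have \<kappa>1: "1 \<le> \<kappa>" using c by (simp add: \<kappa>_def)
  have \<rho>1: "0 < \<rho>" "\<rho> < 1" "\<rho> * c ^ 4 = 1" using c by (auto simp: \<rho> divide_less_eq_1)
  show ?thesis
    using tail_eventually_le[OF \<epsilon>, of "1 / (2 * \<sigma>) + 1"] large_zero_large_index[of K] eventually_gt_at_top[of 0]
  proof eventually_elim
    case (elim R)
    show ?case
    proof (intro allI impI)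
      fix M :: nat and n :: int and u :: real
      assume M: "real M + 1 \<le> (1 + \<sigma>) * R" and n: "\<bar>n\<bar> \<le> int M" and u: "\<bar>u\<bar> \<le> R" "\<bar>u - \<rho> * of_int n\<bar> \<le> \<rho> / 2"
      have nM: "\<bar>of_int n\<bar> \<le> real M" using n by linarith
      have pos: "0 \<le> tail of_int M (of_int n)" by (rule ints.tail_nonneg[OF nM])
      have "\<bar>u\<bar> \<le> \<bar>\<rho> * of_int n\<bar> + \<rho> / 2" using u(2) by linarith
      then have un: "\<bar>u\<bar> \<le> \<rho> * (\<bar>of_int n\<bar> + 1 / 2)" using \<rho>1 by (simp add: abs_mult algebra_simps)
      \<comment> \<open>Near the origin a half step is not small relative to \<open>n\<close>; there
        \<open>u\<close> is bounded and its tail is below \<open>\<epsilon>\<close> by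
        itself.\<close>
      show "tail p R u \<le> tail of_int M (of_int n) + \<epsilon>"
      proof (cases "\<bar>of_int n\<bar> \<le> 1 / (2 * \<sigma>)")
        case True
        have "\<rho> * (\<bar>of_int n\<bar> + 1 / 2) \<le> 1 * (\<bar>of_int n\<bar> + 1 / 2)"
          using \<rho>1 by (intro mult_right_mono) auto
        then have "\<bar>u\<bar> \<le> 1 * (\<bar>of_int n\<bar> + 1 / 2)" using un by (rule order_trans[rotated])
        also have "\<dots> \<le> \<bar>of_int n\<bar> + 1" by simp
        finally have "\<bar>u\<bar> \<le> \<bar>of_int n\<bar> + 1" .
        then have "\<bar>u\<bar> \<le> 1 / (2 * \<sigma>) + 1" using add_right_mono[OF True, of 1] by (rule order_trans)
        then have "tail p R u \<le> \<epsilon>" using elim by blast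
        then show ?thesis using pos by simp
      next
        case False
        then have "1 / 2 \<le> \<sigma> * \<bar>of_int n\<bar>" using \<sigma> by (simp add: field_simps)
        then have "\<bar>of_int n\<bar> + 1 / 2 \<le> c * \<bar>of_int n\<bar>" by (simp add: c_def algebra_simps)
        then have "\<bar>u\<bar> \<le> \<rho> * (c * \<bar>of_int n\<bar>)"
          using un \<rho>1 by (meson less_imp_le mult_left_mono order_trans)
        then have "c ^ 3 * \<bar>u\<bar> \<le> c ^ 3 * (\<rho> * (c * \<bar>of_int n\<bar>))"
          using c by (intro mult_left_mono) auto
        also have "\<dots> = (\<rho> * c ^ 4) * \<bar>of_int n\<bar>" by (simp add: power_numeral_reduce mult_ac)
        finally have un3: "c ^ 3 * \<bar>u\<bar> \<le> \<bar>of_int n\<bar>" using \<rho>1 by simp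
        have n0: "n \<noteq> 0" using False \<sigma> by auto
        have sgn: "0 \<le> u * of_int n"
        proof -
          have "1 \<le> \<bar>of_int n :: real\<bar>" using n0 by linarith
          then have "\<rho> * 1 \<le> \<rho> * \<bar>of_int n\<bar>" using \<rho>1 by (intro mult_left_mono) auto
          then have "\<rho> / 2 \<le> \<bar>\<rho> * of_int n\<bar>" using \<rho>1 by (simp add: abs_mult)
          then have "\<bar>u - \<rho> * of_int n\<bar> \<le> \<bar>\<rho> * of_int n\<bar>" using u(2) by linarith
          then show ?thesis using \<rho>1 by (cases "0 < n") (auto simp: zero_le_mult_iff abs_if mult_less_0_iff split: if_splits)
        qed
        have "tail p R u \<le> tail of_int M (of_int n)"
        proof (rule tail_le_tail[where g = "stretch \<kappa>"])
          fix j assume j: "R < \<bar>p j\<bar>"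
          then have jK: "K \<le> \<bar>j\<bar>" using elim by blast
          have jp: "\<bar>of_int j\<bar> \<le> c * \<bar>p j\<bar>" "\<bar>p j\<bar> \<le> c * \<bar>of_int j\<bar>" using K(2)[OF jK] by (auto simp: c_def)
          have j0: "j \<noteq> 0" using jK K(1) by auto
          have "c * R \<le> c * (c * \<bar>of_int j\<bar>)" using c jp(2) j by (intro mult_left_mono) auto
          then have "real M + 1 \<le> \<kappa> * \<bar>of_int j\<bar>" using M by (simp add: \<kappa>_def power2_eq_square c_def mult_ac)
          \<comment> \<open>The 1 added to \<open>M\<close> in the hypothesis pays for the
            rounding.\<close>
          then show "real M < \<bar>of_int (stretch \<kappa> j)\<bar>" using abs_stretch_gt[OF \<kappa>1, of j] by linarith
          show "0 \<le> (of_int n / of_int (stretch \<kappa> j) - u / p j) * (u / p j)"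
          proof (rule quotient_dominated[OF sgn])
            have "0 < (p j * of_int j) * (of_int (j * stretch \<kappa> j))"
              using same_sign[OF j0] stretch_nonzero[OF \<kappa>1 j0] by (simp only: zero_less_mult_iff of_int_0_less_iff) simp
            also have "\<dots> = (of_int j)\<^sup>2 * (p j * of_int (stretch \<kappa> j))" by (simp add: power2_eq_square mult_ac)
            finally show "0 < p j * of_int (stretch \<kappa> j)" by (simp add: zero_less_mult_iff)
            have "\<bar>u\<bar> * \<bar>of_int (stretch \<kappa> j)\<bar> \<le> \<bar>u\<bar> * (\<kappa> * (c * \<bar>p j\<bar>))"
              using abs_stretch_le[OF \<kappa>1, of j] jp(1) \<kappa>1
              by (intro mult_left_mono order_trans[OF _ mult_left_mono[OF jp(1)]]) auto
            also have "\<dots> = (c ^ 3 * \<bar>u\<bar>) * \<bar>p j\<bar>" by (simp add: \<kappa>_def power_numeral_reduce mult_ac)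
            also have "\<dots> \<le> \<bar>of_int n\<bar> * \<bar>p j\<bar>" using un3 by (intro mult_right_mono) auto
            finally show "\<bar>u\<bar> * \<bar>of_int (stretch \<kappa> j)\<bar> \<le> \<bar>of_int n\<bar> * \<bar>p j\<bar>" .
          qed
        qed (use u nM inj_stretch[OF \<kappa>1] sparse_zeros_axioms ints.sparse_zeros_axioms in auto)
        then show ?thesis using \<epsilon> by simp
      qed
    qed
  qed
qed

text \<open>The comparison for the test functions: the nodes are sparser than the zeros and centred
  at \<open>v\<close>, and the displacement to be absorbed is \<open>\<bar>v\<bar> <= A\<close>
  instead of half a step. It holds up to \<open>\<bar>u\<bar> = R\<close>, as the norm of the test
  function requires.\<close>

lemma tail_int_le_tail:
  assumes \<sigma>: "0 < \<sigma>" and \<epsilon>: "0 < \<epsilon>" and \<sigma>1: "\<sigma> \<le> 1"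
  shows "\<forall>\<^sub>F R in at_top. \<forall>M::nat. \<forall>u v.
      R + 1 \<le> (1 + \<sigma>) * real M \<longrightarrow> \<bar>u\<bar> \<le> R \<longrightarrow> \<bar>v\<bar> \<le> A \<longrightarrow>
      \<bar>(u - v) / (1 + \<sigma>) ^ 4\<bar> \<le> real M \<and> tail of_int M ((u - v) / (1 + \<sigma>) ^ 4) \<le> tail p R u + \<epsilon>"
proof -
  obtain K where K: "0 < K" "\<And>n. K \<le> \<bar>n\<bar> \<Longrightarrow> \<bar>of_int n\<bar> \<le> (1 + \<sigma>) * \<bar>p n\<bar> \<and> \<bar>p n\<bar> \<le> (1 + \<sigma>) * \<bar>of_int n\<bar>"
    using near_integers[OF \<sigma>] by blast
  define c where "c = 1 + \<sigma>"
  have c: "1 < c" "c = 1 + \<sigma>" using \<sigma> by (auto simp: c_def)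
  have c1: "1 < c ^ 4" using c by simp
  define \<kappa> where "\<kappa> = c\<^sup>2"
  have \<kappa>1: "1 \<le> \<kappa>" using c by (simp add: \<kappa>_def)
  obtain T where T: "\<And>S u. T \<le> S \<Longrightarrow> \<bar>u\<bar> \<le> A / \<sigma> + A \<Longrightarrow> tail of_int S u \<le> \<epsilon>"
    using ints.tail_eventually_le[OF \<epsilon>, of "A / \<sigma> + A"] by (auto simp: eventually_at_top_linorder)
  show ?thesis
    using eventually_ge_at_top[of "c * T"] eventually_ge_at_top[of "A / \<sigma>"]
      eventually_ge_at_top[of "of_int K"] eventually_gt_at_top[of 0]
  proof eventually_elim
    case (elim R)
    show ?case
    proof (intro allI impI)
      fix M :: nat and u v :: real
      assume M: "R + 1 \<le> (1 + \<sigma>) * real M" and u: "\<bar>u\<bar> \<le> R" and v: "\<bar>v\<bar> \<le> A"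
      define s where "s = (u - v) / c ^ 4"
      have sc: "\<bar>s\<bar> * c ^ 4 = \<bar>u - v\<bar>" using c by (simp add: s_def)
      have s: "\<bar>s\<bar> \<le> \<bar>u - v\<bar>"
        using mult_left_mono[of 1 "c ^ 4" "\<bar>s\<bar>"] c1 sc by simp
      have "A \<le> \<sigma> * R" using elim(2) \<sigma> by (simp add: field_simps)
      have "\<bar>s\<bar> * c ^ 4 \<le> R + A" using sc u v by linarith
      also have "\<dots> \<le> c * R" using \<open>A \<le> \<sigma> * R\<close> by (simp add: c_def algebra_simps)
      also have "\<dots> \<le> c * (c * real M)" using M c by (intro mult_left_mono) auto
      also have "\<dots> = real M * c\<^sup>2" by (simp add: power2_eq_square)
      also have "\<dots> \<le> real M * c ^ 4" using c by (intro mult_left_mono power_increasing) auto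
      finally have sM: "\<bar>s\<bar> \<le> real M" using c by simp
      have pos: "0 \<le> tail p R u" by (rule tail_nonneg[OF u])
      have "tail of_int M s \<le> tail p R u + \<epsilon>"
      \<comment> \<open>Beyond \<open>A / \<sigma>\<close> the shift by \<open>v\<close> costs at
        most a factor \<open>c\<close>; up to there the argument \<open>s\<close> is bounded and the
        integer tail is small by itself.\<close>
      proof (cases "\<bar>u\<bar> \<le> A / \<sigma>")
        case True
        have "c * T \<le> c * real M" using elim(1) M by (simp add: c_def)
        then have "T \<le> real M" using c by simp
        moreover have "\<bar>s\<bar> \<le> A / \<sigma> + A" using s True v by linarith
        ultimately have "tail of_int M s \<le> \<epsilon>" using T by blast
        then show ?thesis using pos by simp
      next
        case False
        then have Au: "A \<le> \<sigma> * \<bar>u\<bar>" using \<sigma> by (simp add: field_simps)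
        have "\<bar>s\<bar> * c ^ 4 \<le> c * \<bar>u\<bar>" using sc v Au by (simp add: c_def algebra_simps)
        then have su: "\<bar>s\<bar> * c ^ 3 \<le> \<bar>u\<bar>" using c by (simp add: power_numeral_reduce)
        have sgn: "0 \<le> s * u"
        proof -
          \<comment> \<open>\<open>\<sigma> <= 1\<close> keeps \<open>u - v\<close> on the same side
            of 0 as \<open>u\<close>.\<close>
          have "\<sigma> * \<bar>u\<bar> \<le> 1 * \<bar>u\<bar>" using \<sigma>1 by (intro mult_right_mono) auto
          then have "\<bar>v\<bar> \<le> \<bar>u\<bar>" using v Au by linarith
          then have "0 \<le> (u - v) * u" by (auto simp: zero_le_mult_iff abs_if split: if_splits)
          then show ?thesis using c1 by (simp add: s_def)
        qed
        have "tail of_int M s \<le> tail p R u"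
        proof (rule tail_le_tail[where g = "stretch \<kappa>"])
          fix j :: int assume j: "real M < \<bar>of_int j\<bar>"
          then have "int M + 1 \<le> \<bar>j\<bar>" by linarith
          then have "real_of_int (int M + 1) \<le> of_int \<bar>j\<bar>" by (simp only: of_int_le_iff)
          then have "real M + 1 \<le> \<bar>of_int j\<bar>" by simp
          then have "\<kappa> * (real M + 1) \<le> \<kappa> * \<bar>of_int j\<bar>" using \<kappa>1 by (intro mult_left_mono) auto
          moreover have "\<kappa> * (real M + 1) = c * (c * real M) + \<kappa>" by (simp add: \<kappa>_def power2_eq_square algebra_simps)
          moreover have "c * (R + 1) \<le> c * (c * real M)" using M c by (intro mult_left_mono) auto
          \<comment> \<open>The surplus \<open>\<kappa> >= 1\<close>, gained from
            \<open>M + 1 <= \<bar>j\<bar>\<close>, pays for the rounding.\<close>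
          ultimately have g: "c * (R + 1) \<le> \<bar>of_int (stretch \<kappa> j)\<bar>"
            using abs_stretch_gt[OF \<kappa>1, of j] \<kappa>1 by linarith
          have "of_int K \<le> 1 * (R + 1)" using elim by simp
          also have "\<dots> \<le> c * (R + 1)" using c elim by (intro mult_right_mono) auto
          also note g
          finally have "of_int K \<le> (of_int \<bar>stretch \<kappa> j\<bar> :: real)" by simp
          then have gK: "K \<le> \<bar>stretch \<kappa> j\<bar>" by (simp only: of_int_le_iff)
          have gp: "\<bar>of_int (stretch \<kappa> j)\<bar> \<le> c * \<bar>p (stretch \<kappa> j)\<bar>"
            "\<bar>p (stretch \<kappa> j)\<bar> \<le> c * \<bar>of_int (stretch \<kappa> j)\<bar>" using K(2)[OF gK] by (auto simp: c_def)
          have "c * (R + 1) \<le> c * \<bar>p (stretch \<kappa> j)\<bar>" using g gp(1) by (rule order_trans)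
          then show "R < \<bar>p (stretch \<kappa> j)\<bar>" using c by simp
          have j0: "j \<noteq> 0" using j by auto
          have g0: "stretch \<kappa> j \<noteq> 0" using gK K(1) by auto
          show "0 \<le> (u / p (stretch \<kappa> j) - s / of_int j) * (s / of_int j)"
          proof (rule quotient_dominated[OF sgn])
            have "0 < (p (stretch \<kappa> j) * of_int (stretch \<kappa> j)) * (of_int (j * stretch \<kappa> j))"
              using same_sign[OF g0] stretch_nonzero[OF \<kappa>1 j0] by (simp only: zero_less_mult_iff of_int_0_less_iff) simp
            also have "\<dots> = (of_int (stretch \<kappa> j))\<^sup>2 * (of_int j * p (stretch \<kappa> j))" by (simp add: power2_eq_square mult_ac)
            finally show "0 < of_int j * p (stretch \<kappa> j)" by (simp add: zero_less_mult_iff)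
            have "\<bar>s\<bar> * \<bar>p (stretch \<kappa> j)\<bar> \<le> \<bar>s\<bar> * (c * (\<kappa> * \<bar>of_int j\<bar>))"
              using c by (intro mult_left_mono order_trans[OF gp(2)] abs_stretch_le \<kappa>1) auto
            also have "\<dots> = (\<bar>s\<bar> * c ^ 3) * \<bar>of_int j\<bar>" by (simp add: \<kappa>_def power_numeral_reduce mult_ac)
            also have "\<dots> \<le> \<bar>u\<bar> * \<bar>of_int j\<bar>" using su by (intro mult_right_mono) auto
            finally show "\<bar>s\<bar> * \<bar>p (stretch \<kappa> j)\<bar> \<le> \<bar>u\<bar> * \<bar>of_int j\<bar>" .
          qed
        qed (use u sM inj_stretch[OF \<kappa>1] sparse_zeros_axioms ints.sparse_zeros_axioms in auto)
        then show ?thesis using \<epsilon> by simp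
      qed
      then show "\<bar>(u - v) / (1 + \<sigma>) ^ 4\<bar> \<le> real M \<and> tail of_int M ((u - v) / (1 + \<sigma>) ^ 4) \<le> tail p R u + \<epsilon>"
        using sM by (simp add: s_def c_def)
    qed
  qed
qed

end

subsection \<open>The weight\<close>

context almost_integers
begin

text \<open>The conditionally convergent sum of \<open>1 / p n\<close> over
  \<open>\<bar>p n\<bar> > R\<close>, written as the full limit minus a finite sum.\<close>

definition eta :: "real \<Rightarrow> real" where
  "eta R = Lim at_top (\<lambda>S::real. \<Sum>n\<in>{n. 0 < \<bar>p n\<bar> \<and> \<bar>p n\<bar> < S}. 1 / p n)
     - (\<Sum>n\<in>{n. 0 < \<bar>p n\<bar> \<and> \<bar>p n\<bar> \<le> R}. 1 / p n)"

lemma tendsto_sum_inverse: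
  "((\<lambda>S. \<Sum>n\<in>{n. 0 < \<bar>p n\<bar> \<and> \<bar>p n\<bar> < S}. 1 / p n)
     \<longlongrightarrow> Lim at_top (\<lambda>S::real. \<Sum>n\<in>{n. 0 < \<bar>p n\<bar> \<and> \<bar>p n\<bar> < S}. 1 / p n)) at_top"
proof -
  obtain L where L: "((\<lambda>S::real. \<Sum>n\<in>{n. 0 < \<bar>p n\<bar> \<and> \<bar>p n\<bar> < S}. 1 / p n) \<longlongrightarrow> L) at_top"
    using sum_conv by blast
  then show ?thesis using tendsto_Lim[OF trivial_limit_at_top_linorder L] by simp
qed

lemma finite_window: "finite {n. a < \<bar>p n\<bar> \<and> \<bar>p n\<bar> < S}" "finite {n. a < \<bar>p n\<bar> \<and> \<bar>p n\<bar> \<le> S}"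
  by (rule finite_subset[OF _ finite_le[of S]]; auto)+

lemma tendsto_eta:
  assumes "0 \<le> R"
  shows "((\<lambda>S. \<Sum>n\<in>{n. R < \<bar>p n\<bar> \<and> \<bar>p n\<bar> < S}. 1 / p n) \<longlongrightarrow> eta R) at_top"
proof (rule Lim_transform_eventually)
  show "((\<lambda>S. (\<Sum>n\<in>{n. 0 < \<bar>p n\<bar> \<and> \<bar>p n\<bar> < S}. 1 / p n) - (\<Sum>n\<in>{n. 0 < \<bar>p n\<bar> \<and> \<bar>p n\<bar> \<le> R}. 1 / p n)) \<longlongrightarrow> eta R) at_top"
    unfolding eta_def by (intro tendsto_intros tendsto_sum_inverse)
  show "\<forall>\<^sub>F S in at_top. (\<Sum>n\<in>{n. 0 < \<bar>p n\<bar> \<and> \<bar>p n\<bar> < S}. 1 / p n) - (\<Sum>n\<in>{n. 0 < \<bar>p n\<bar> \<and> \<bar>p n\<bar> \<le> R}. 1 / p n)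
      = (\<Sum>n\<in>{n. R < \<bar>p n\<bar> \<and> \<bar>p n\<bar> < S}. 1 / p n)"
    using eventually_gt_at_top[of R]
  proof eventually_elim
    case (elim S)
    have "{n. 0 < \<bar>p n\<bar> \<and> \<bar>p n\<bar> < S} = {n. 0 < \<bar>p n\<bar> \<and> \<bar>p n\<bar> \<le> R} \<union> {n. R < \<bar>p n\<bar> \<and> \<bar>p n\<bar> < S}"
      using elim assms by auto
    then have "(\<Sum>n\<in>{n. 0 < \<bar>p n\<bar> \<and> \<bar>p n\<bar> < S}. 1 / p n) =
       (\<Sum>n\<in>{n. 0 < \<bar>p n\<bar> \<and> \<bar>p n\<bar> \<le> R}. 1 / p n) + (\<Sum>n\<in>{n. R < \<bar>p n\<bar> \<and> \<bar>p n\<bar> < S}. 1 / p n)"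
      by (simp only:) (rule sum.union_disjoint[OF finite_window(2) finite_window(1)], auto)
    then show ?case by simp
  qed
qed

lemma eta_tendsto_0: "(eta \<longlongrightarrow> 0) at_top"
proof (rule tendstoI)
  fix e :: real assume "0 < e"
  define L where "L = Lim at_top (\<lambda>S::real. \<Sum>n\<in>{n. 0 < \<bar>p n\<bar> \<and> \<bar>p n\<bar> < S}. 1 / p n)"
  obtain S0 where S0: "\<And>S. S0 \<le> S \<Longrightarrow> dist (\<Sum>n\<in>{n. 0 < \<bar>p n\<bar> \<and> \<bar>p n\<bar> < S}. 1 / p n) L < e"
    using tendstoD[OF tendsto_sum_inverse \<open>0 < e\<close>] unfolding L_def by (auto simp: eventually_at_top_linorder)
  show "\<forall>\<^sub>F R in at_top. dist (eta R) 0 < e"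
    using eventually_ge_at_top[of S0]
  proof eventually_elim
    case (elim R)
    \<comment> \<open>The limit is taken over windows with strict bound \<open>S\<close>, while
      \<open>eta R\<close> subtracts a closed window. Choosing \<open>S > R\<close> so that no
      modulus of a zero lies strictly between them makes the two windows coincide.\<close>
    define X where "X = insert (R + 1) ((\<lambda>n. \<bar>p n\<bar>) ` {n. R < \<bar>p n\<bar> \<and> \<bar>p n\<bar> < R + 1})"
    have X: "finite X" "X \<noteq> {}" unfolding X_def using finite_window by auto
    define S where "S = Min X"
    have "R < S" using Min_in[OF X] by (auto simp: S_def X_def)
    have "\<bar>p n\<bar> \<le> R" if "\<bar>p n\<bar> < S" for n
    proof (rule ccontr)
      assume "\<not> \<bar>p n\<bar> \<le> R"
      moreover have "S \<le> R + 1" unfolding S_def by (rule Min_le) (use X in \<open>auto simp: X_def\<close>)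
      ultimately have "\<bar>p n\<bar> \<in> X" using that by (auto simp: X_def)
      then show False using that Min_le[OF X(1)] unfolding S_def by fastforce
    qed
    then have "{n. 0 < \<bar>p n\<bar> \<and> \<bar>p n\<bar> \<le> R} = {n. 0 < \<bar>p n\<bar> \<and> \<bar>p n\<bar> < S}"
      using \<open>R < S\<close> by force
    moreover have "S0 \<le> S" using elim \<open>R < S\<close> by simp
    ultimately show ?case using S0[of S] by (simp add: eta_def L_def dist_real_def abs_minus_commute)
  qed
qed

text \<open>This is the product \<open>E\<close>, with its logarithm split into the conditionally
  and the absolutely convergent part.\<close>

definition outer :: "real \<Rightarrow> real \<Rightarrow> real" where
  "outer R u = exp (- eta R * u - tail p R u)"

lemma outer_pos: "0 < outer R u"
  by (simp add: outer_def)

lemma tendsto_zero_weight: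
  assumes "0 \<le> R" "\<bar>t\<bar> \<le> 1"
  shows "((\<lambda>S. \<Prod>n\<in>{n. R < \<bar>p n\<bar> \<and> \<bar>p n\<bar> < S}. (1 - R * t / p n)\<^sup>2) \<longlongrightarrow> (outer R (R * t))\<^sup>2) at_top"
proof -
  have u: "\<bar>R * t\<bar> \<le> R" using assms by (simp add: abs_mult mult_left_le)
  have "((\<lambda>S. (exp (- (\<Sum>n\<in>{n. R < \<bar>p n\<bar> \<and> \<bar>p n\<bar> < S}. 1 / p n) * (R * t)
       - (\<Sum>n\<in>{n. R < \<bar>p n\<bar> \<and> \<bar>p n\<bar> < S}. psi (R * t / p n))))\<^sup>2) \<longlongrightarrow> (outer R (R * t))\<^sup>2) at_top"
    unfolding outer_def by (intro tendsto_intros tendsto_eta tendsto_tail u assms)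
  moreover have "(exp (- (\<Sum>n\<in>{n. R < \<bar>p n\<bar> \<and> \<bar>p n\<bar> < S}. 1 / p n) * (R * t)
       - (\<Sum>n\<in>{n. R < \<bar>p n\<bar> \<and> \<bar>p n\<bar> < S}. psi (R * t / p n))))\<^sup>2
       = (\<Prod>n\<in>{n. R < \<bar>p n\<bar> \<and> \<bar>p n\<bar> < S}. (1 - R * t / p n)\<^sup>2)" for S
  proof -
    let ?W = "{n. R < \<bar>p n\<bar> \<and> \<bar>p n\<bar> < S}"
    have "- (\<Sum>n\<in>?W. 1 / p n) * (R * t) - (\<Sum>n\<in>?W. psi (R * t / p n)) = (\<Sum>n\<in>?W. - (R * t / p n) - psi (R * t / p n))"
      by (simp add: sum_distrib_right sum_subtractf sum_negf)
    then have "exp (- (\<Sum>n\<in>?W. 1 / p n) * (R * t) - (\<Sum>n\<in>?W. psi (R * t / p n)))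
       = (\<Prod>n\<in>?W. exp (- (R * t / p n) - psi (R * t / p n)))"
      using finite_window by (simp add: exp_sum)
    also have "\<dots> = (\<Prod>n\<in>?W. 1 - R * t / p n)"
    proof (rule prod.cong[OF refl])
      fix n assume "n \<in> ?W"
      then have "R * t / p n < 1" using quotient_less_1[OF u] by simp
      then show "exp (- (R * t / p n) - psi (R * t / p n)) = 1 - R * t / p n"
        by (simp add: psi_def)
    qed
    finally show ?thesis by (simp add: prod_power_distrib)
  qed
  ultimately show ?thesis by simp
qed

lemma zero_weight_eq:
  assumes "0 \<le> R"
  shows "zero_weight p R t = (if \<bar>t\<bar> \<le> 1 then (outer R (R * t))\<^sup>2 else 0)"
  using tendsto_Lim[OF _ tendsto_zero_weight[OF assms]] by (auto simp: zero_weight_def)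

lemma sqrt_zero_weight:
  assumes "0 \<le> R" "\<bar>t\<bar> \<le> 1"
  shows "sqrt (zero_weight p R t) = outer R (R * t)"
  using assms outer_pos[of R "R * t"] by (simp add: zero_weight_eq)

lemma borel_measurable_zero_weight:
  assumes "0 \<le> R" shows "zero_weight p R \<in> borel_measurable borel"
proof (rule borel_measurable_LIMSEQ_real)
  show "(\<lambda>k. indicator {-1..1} t * (\<Prod>n\<in>{n. R < \<bar>p n\<bar> \<and> \<bar>p n\<bar> < real k}. (1 - R * t / p n)\<^sup>2)) \<longlonglongrightarrow> zero_weight p R t" for t
  proof (cases "\<bar>t\<bar> \<le> 1")
    case True
    from filterlim_compose[OF tendsto_zero_weight[OF assms True] filterlim_real_sequentially]
    show ?thesis using True by (simp add: zero_weight_eq[OF assms] indicator_def abs_le_iff)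
  next
    case False
    then have "indicator {-1..1} t = (0::real)" by (auto simp: indicator_def)
    then show ?thesis using False by (simp add: zero_weight_eq[OF assms])
  qed
qed measurable

text \<open>Tails are nonnegative, so only the linear term of the exponent can make the weight
  large.\<close>

lemma zero_weight_bounded:
  assumes "0 \<le> R" shows "zero_weight p R t \<le> (exp (\<bar>eta R\<bar> * R))\<^sup>2 * indicator {-1..1} t"
proof (cases "\<bar>t\<bar> \<le> 1")
  case True
  then have u: "\<bar>R * t\<bar> \<le> R" using assms by (simp add: abs_mult mult_left_le)
  have "- eta R * (R * t) \<le> \<bar>eta R\<bar> * \<bar>R * t\<bar>" by (metis abs_ge_self abs_minus_cancel abs_mult)
  also have "\<dots> \<le> \<bar>eta R\<bar> * R" using u by (intro mult_left_mono) auto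
  finally have "outer R (R * t) \<le> exp (\<bar>eta R\<bar> * R)"
    using tail_nonneg[OF u] by (simp add: outer_def)
  then have "(outer R (R * t))\<^sup>2 \<le> (exp (\<bar>eta R\<bar> * R))\<^sup>2"
    using outer_pos[of R "R * t"] by (intro power_mono) auto
  then show ?thesis using True by (simp add: zero_weight_eq[OF assms] abs_le_iff)
qed (auto simp: zero_weight_eq[OF assms])

lemma zero_weight_nonneg: "0 \<le> R \<Longrightarrow> 0 \<le> zero_weight p R t"
  by (simp add: zero_weight_eq)

lemma poly_weight_zero_weight:
  assumes R: "0 \<le> R" shows "poly_weight (zero_weight p R)"
proof
  note [measurable] = borel_measurable_zero_weight[OF R]
  show int: "integrable lborel (\<lambda>t. poly q t * zero_weight p R t)" for q
  proof (rule Bochner_Integration.integrable_bound)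
    let ?B = "(exp (\<bar>eta R\<bar> * R))\<^sup>2"
    show "integrable lborel (\<lambda>t. indicator {-1..1} t *\<^sub>R (?B * \<bar>poly q t\<bar>))"
      by (rule borel_integrable_compact) (auto intro!: continuous_intros)
    have "poly q \<in> borel_measurable borel"
      by (intro borel_measurable_continuous_onI continuous_intros)
    then show "(\<lambda>t. poly q t * zero_weight p R t) \<in> borel_measurable lborel"
      by simp
    have "norm (poly q t * zero_weight p R t) \<le> norm (indicator {-1..1} t *\<^sub>R (?B * \<bar>poly q t\<bar>))" for t
    proof -
      have "\<bar>poly q t\<bar> * zero_weight p R t \<le> \<bar>poly q t\<bar> * (?B * indicator {-1..1} t)"
        using zero_weight_bounded[OF R] by (intro mult_left_mono) auto
      then show ?thesis using zero_weight_nonneg[OF R, of t] by (simp add: abs_mult mult_ac)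
    qed
    then show "AE t in lborel. norm (poly q t * zero_weight p R t) \<le> norm (indicator {-1..1} t *\<^sub>R (?B * \<bar>poly q t\<bar>))"
      by simp
  qed
  fix q :: "real poly" assume q: "q \<noteq> 0"
  let ?f = "\<lambda>t. poly (q * q) t * zero_weight p R t"
  have nn: "0 \<le> ?f t" for t using zero_weight_nonneg[OF R, of t] by simp
  have "(\<integral>t. ?f t \<partial>lborel) \<noteq> 0"
  proof
    assume "(\<integral>t. ?f t \<partial>lborel) = 0"
    then have "AE t in lborel. ?f t = 0"
      using integral_nonneg_eq_0_iff_AE[OF int[of "q * q"]] nn by simp
    \<comment> \<open>The weight vanishes nowhere on \<open>[-1, 1]\<close>, so a zero integral
      would leave almost every point of the interval among the finitely many roots of
      \<open>q\<close>.\<close>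
    then have "AE t in lborel. t \<notin> {-1..1} - {t. poly q t = 0}"
    proof (rule AE_mp, intro AE_I2 impI)
      fix t assume "?f t = 0"
      then show "t \<notin> {-1..1} - {t. poly q t = 0}"
        using outer_pos[of R "R * t"] by (auto simp: zero_weight_eq[OF R] abs_le_iff)
    qed
    moreover have "AE t in lborel. t \<notin> {t. poly q t = 0}"
      by (rule AE_not_in) (use poly_roots_finite[OF q] in \<open>auto intro: finite_imp_null_set_lborel\<close>)
    ultimately have "AE t in lborel. t \<notin> {-1..1::real}"
      by eventually_elim auto
    then have "emeasure lborel {-1..1::real} = 0"
      by (subst (asm) AE_iff_measurable[of "{-1..1}"]) auto
    then show False by simp
  qed
  moreover have "0 \<le> (\<integral>t. ?f t \<partial>lborel)" by (rule Bochner_Integration.integral_nonneg) (rule nn)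
  ultimately show "0 < (\<integral>t. ?f t \<partial>lborel)" by simp
qed

end

subsection \<open>Bounds for the kernel\<close>

lemma exp_le_one_minus:
  assumes "0 \<le> (\<delta>::real)" "\<delta> \<le> 1 / 2" shows "exp (- 2 * \<delta>) \<le> 1 - \<delta>"
proof -
  have "\<delta> * \<delta> \<le> \<delta> * (1 / 2)" using assms by (intro mult_left_mono) auto
  then have "- 2 * \<delta> \<le> ln (1 - \<delta>)"
    using ln_one_minus_pos_lower_bound[of \<delta>] assms by (simp add: power2_eq_square)
  then have "exp (- 2 * \<delta>) \<le> exp (ln (1 - \<delta>))" by (simp only: exp_le_cancel_iff)
  then show ?thesis using assms by simp
qed

text \<open>The upper bound serves over the whole interval; the lower one is Bernoulli's inequality
  and is useful only for small \<open>x\<close>.\<close>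

lemma one_plus_power_bounds:
  fixes x :: real and m :: nat
  assumes "\<bar>x\<bar> \<le> real m" "0 < m"
  shows "0 \<le> (1 + x / real m) ^ m" "(1 + x / real m) ^ m \<le> exp x" "1 + x \<le> (1 + x / real m) ^ m"
proof -
  have l: "- 1 \<le> x / real m" using assms by (simp add: le_divide_eq)
  then show "0 \<le> (1 + x / real m) ^ m" by (intro zero_le_power) simp
  have "(1 + x / real m) ^ m \<le> exp (x / real m) ^ m"
    using l by (intro power_mono) (auto simp: exp_ge_add_one_self)
  also have "\<dots> = exp x" using assms by (simp flip: exp_of_nat_mult)
  finally show "(1 + x / real m) ^ m \<le> exp x" .
  show "1 + x \<le> (1 + x / real m) ^ m"
    using Bernoulli_inequality[OF l, of m] assms by simp
qed

context almost_integers
begin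

text \<open>The factor \<open>(1 - \<eta> u / m)\<^sup>m \<le> exp (- \<eta> u)\<close> absorbs, at the cost of \<open>m\<close> degrees,
  the linear term in the exponent of \<open>outer\<close>, which is not controlled for large \<open>u\<close>.\<close>

lemma value_bound_nodes:
  assumes R: "0 < R" and \<rho>: "0 < \<rho>" and \<delta>: "0 \<le> \<delta>" "\<delta> \<le> 1 / 2"
    and m: "0 < m" "\<bar>eta R\<bar> * R \<le> real m" and deg: "degree P + m \<le> 2 * M"
    and nodes: "\<rho> * (real M + 1 / 2) \<le> R" and A: "0 \<le> A" "A + \<rho> \<le> \<rho> * real M"
    and cmp: "\<And>n u. \<bar>n\<bar> \<le> int M \<Longrightarrow> \<bar>u\<bar> \<le> R \<Longrightarrow> \<bar>u - \<rho> * of_int n\<bar> \<le> \<rho> / 2 \<Longrightarrow>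
        tail p R u \<le> tail of_int M (of_int n) + \<delta>"
    and near: "\<And>x. \<bar>x\<bar> \<le> A / \<rho> + 1 \<Longrightarrow> tail of_int M x \<le> \<delta>"
    and eta: "\<bar>eta R\<bar> * A \<le> \<delta>"
    and v: "\<bar>v\<bar> \<le> A" and \<theta>: "\<bar>\<theta>\<bar> \<le> \<rho> / 2"
  shows "(poly P (v / R) * outer R v)\<^sup>2 \<le> (exp (5 * \<delta>))\<^sup>2 *
     (\<Sum>n=-int M..int M. (poly P ((\<theta> + of_int n * \<rho>) / R) * outer R (\<theta> + of_int n * \<rho>))\<^sup>2)"
proof -
  let ?I = "{-int M..int M}"
  define u where "u n = \<theta> + of_int n * \<rho>" for n :: int
  define f where "f x = poly P (x / R) * outer R x" for x
  define h where "h x = (1 + (- eta R * x) / real m) ^ m" for x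
  define \<tau> where "\<tau> = (v - \<theta>) / \<rho>"
  have \<tau>v: "\<theta> + \<rho> * \<tau> = v" using \<rho> by (simp add: \<tau>_def)
  have uR: "\<bar>u n\<bar> \<le> R" if "n \<in> ?I" for n
  proof -
    have "\<bar>of_int n * \<rho>\<bar> \<le> real M * \<rho>" using that \<rho> by (auto simp: abs_mult intro!: mult_right_mono)
    then have "\<bar>u n\<bar> \<le> \<rho> / 2 + real M * \<rho>" unfolding u_def using \<theta> by (intro order_trans[OF abs_triangle_ineq] add_mono)
    also have "\<dots> = \<rho> * (real M + 1 / 2)" by (simp add: algebra_simps)
    finally show ?thesis using nodes by simp
  qed
  have AR: "A \<le> R"
  proof -
    have "A \<le> \<rho> * real M" using A \<rho> by simp
    also have "\<dots> \<le> \<rho> * (real M + 1 / 2)" using \<rho> by simp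
    finally show ?thesis using nodes by simp
  qed
  have em: "\<bar>- eta R * x\<bar> \<le> real m" if "\<bar>x\<bar> \<le> R" for x
  proof -
    have "\<bar>- eta R * x\<bar> \<le> \<bar>eta R\<bar> * R" using that by (simp add: abs_mult mult_left_mono)
    then show ?thesis using m by simp
  qed
  have \<tau>A: "\<bar>\<tau>\<bar> \<le> A / \<rho> + 1"
  proof -
    have "\<bar>v - \<theta>\<bar> \<le> A + \<rho>" using v \<theta> \<rho> by linarith
    then show ?thesis using \<rho> by (simp add: \<tau>_def field_simps)
  qed
  have \<tau>M: "\<bar>\<tau>\<bar> \<le> real M"
  proof -
    have "A / \<rho> + 1 \<le> real M" using A(2) \<rho> by (simp add: field_simps)
    then show ?thesis using \<tau>A by simp
  qed
  \<comment> \<open>If \<open>\<tau>\<close> is an integer, \<open>v\<close> is itself a node and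
    its term alone suffices; the bound on the Lagrange basis is for the other case.\<close>
  have main: "(f v)\<^sup>2 \<le> (exp (5 * \<delta>))\<^sup>2 * (\<Sum>n\<in>?I. (f (u n))\<^sup>2)"
  proof (cases "\<tau> \<in> \<int>")
    case True
    then obtain k where k: "\<tau> = of_int k" by (auto elim: Ints_cases)
    have uk: "u k = v" using \<tau>v k by (simp add: u_def mult.commute)
    have "k \<in> ?I" using \<tau>M unfolding k by auto
    then have "(f (u k))\<^sup>2 \<le> (\<Sum>n\<in>?I. (f (u n))\<^sup>2)"
      by (intro member_le_sum) auto
    then have "1 * (f v)\<^sup>2 \<le> (exp (5 * \<delta>))\<^sup>2 * (\<Sum>n\<in>?I. (f (u n))\<^sup>2)"
      unfolding uk using \<delta> by (intro mult_mono one_le_power) auto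
    then show ?thesis by simp
  next
    case False
    \<comment> \<open>\<open>P\<close> times the compensating factor, in the variable that makes the
      nodes integers; its degree has to stay within \<open>2 * M\<close> for the
      \<open>2 * M + 1\<close> nodes.\<close>
    define q where "q = pcompose (P * [:1, - eta R * R / real m:] ^ m) [:\<theta> / R, \<rho> / R:]"
    have q: "poly q x = poly P ((\<theta> + \<rho> * x) / R) * h (\<theta> + \<rho> * x)" for x
    proof -
      have e: "\<theta> / R + x * (\<rho> / R) = (\<theta> + \<rho> * x) / R" by (simp add: add_divide_distrib)
      have k: "1 + (\<theta> + \<rho> * x) / R * (- eta R * R / real m) = 1 + (- eta R * (\<theta> + \<rho> * x)) / real m"
        using R by simp
      have "poly q x = poly P (\<theta> / R + x * (\<rho> / R)) * (1 + (\<theta> / R + x * (\<rho> / R)) * (- eta R * R / real m)) ^ m"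
        by (simp add: q_def poly_pcompose)
      then show ?thesis unfolding e k h_def .
    qed
    have "degree q \<le> 2 * M"
    proof -
      have "degree (P * [:1, - eta R * R / real m:] ^ m) \<le> degree P + degree ([:1, - eta R * R / real m:] ^ m)"
        by (rule degree_mult_le)
      also have "\<dots> \<le> degree P + m"
        using degree_power_le[of "[:1, - eta R * R / real m:]" m] by (auto intro: order_trans split: if_splits)
      also have "\<dots> \<le> 2 * M" by (rule deg)
      finally have "degree (P * [:1, - eta R * R / real m:] ^ m) * degree [:\<theta> / R, \<rho> / R:] \<le> 2 * M" using \<rho> R by simp
      then show ?thesis unfolding q_def using degree_pcompose_le le_trans by blast
    qed
    from lagrange_integers[OF this, of \<tau>]
    have "poly P (v / R) * h v = (\<Sum>n\<in>?I. poly q (of_int n) * node_basis M n \<tau>)"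
      unfolding q \<tau>v by (simp add: q)
    then have "\<bar>poly P (v / R) * h v\<bar> \<le> (\<Sum>n\<in>?I. \<bar>poly q (of_int n) * node_basis M n \<tau>\<bar>)"
      by (simp only: sum_abs)
    also have "\<dots> \<le> (\<Sum>n\<in>?I. exp (2 * \<delta>) * (\<bar>f (u n)\<bar> * \<bar>sinc (\<tau> - of_int n)\<bar>))"
    proof (rule sum_mono)
      fix n assume n: "n \<in> ?I"
      then have nM: "\<bar>n\<bar> \<le> int M" by auto
      have hu: "0 \<le> h (u n)" "h (u n) \<le> exp (- eta R * u n)"
        unfolding h_def using one_plus_power_bounds(1,2)[OF em[OF uR[OF n]] m(1)] .
      have qn: "\<bar>poly q (of_int n)\<bar> = \<bar>poly P (u n / R)\<bar> * h (u n)"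
        using hu by (simp add: q u_def abs_mult mult.commute)
      have "\<bar>u n - \<rho> * of_int n\<bar> \<le> \<rho> / 2" using \<theta> by (simp add: u_def mult.commute)
      then have cmp': "- tail of_int M (of_int n) \<le> \<delta> - tail p R (u n)" using cmp[OF nM uR[OF n]] by simp
      have "\<bar>poly q (of_int n) * node_basis M n \<tau>\<bar> = \<bar>poly P (u n / R)\<bar> * h (u n) * \<bar>node_basis M n \<tau>\<bar>"
        by (simp add: abs_mult qn)
      also have "\<dots> \<le> \<bar>poly P (u n / R)\<bar> * exp (- eta R * u n) * (\<bar>sinc (\<tau> - of_int n)\<bar> * exp (tail of_int M \<tau> - tail of_int M (of_int n)))"
        using hu by (intro mult_mono mult_left_mono abs_node_basis_le False \<tau>M nM) auto
      \<comment> \<open>One \<open>\<delta>\<close> bounds the tail at \<open>\<tau>\<close>, the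
        other is the price of exchanging the integer tail at \<open>n\<close> for the tail of
        \<open>p\<close> at the node.\<close>
      also have "\<dots> \<le> \<bar>poly P (u n / R)\<bar> * exp (- eta R * u n) * (\<bar>sinc (\<tau> - of_int n)\<bar> * exp (2 * \<delta> - tail p R (u n)))"
        using cmp' near[OF \<tau>A] by (intro mult_left_mono) auto
      also have "\<dots> = exp (2 * \<delta>) * (\<bar>f (u n)\<bar> * \<bar>sinc (\<tau> - of_int n)\<bar>)"
        by (simp add: f_def outer_def abs_mult exp_diff)
      finally show "\<bar>poly q (of_int n) * node_basis M n \<tau>\<bar> \<le> exp (2 * \<delta>) * (\<bar>f (u n)\<bar> * \<bar>sinc (\<tau> - of_int n)\<bar>)" .
    qed
    finally have 1: "\<bar>poly P (v / R) * h v\<bar> \<le> exp (2 * \<delta>) * (\<Sum>n\<in>?I. \<bar>f (u n)\<bar> * \<bar>sinc (\<tau> - of_int n)\<bar>)"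
      by (simp only: sum_distrib_left)
    have vR: "\<bar>v\<bar> \<le> R" using v AR by simp
    have ev: "\<bar>- eta R * v\<bar> \<le> \<delta>"
    proof -
      have "\<bar>- eta R * v\<bar> \<le> \<bar>eta R\<bar> * A" using v by (simp add: abs_mult mult_left_mono)
      then show ?thesis using eta by simp
    qed
    have hv: "exp (- 2 * \<delta>) \<le> h v"
      using exp_le_one_minus[OF \<delta>] one_plus_power_bounds(3)[OF em[OF vR] m(1)] ev unfolding h_def by linarith
    have Ev: "outer R v \<le> exp \<delta>" using ev tail_nonneg[OF vR] by (simp add: outer_def)
    have "1 \<le> exp (2 * \<delta>) * h v"
      using mult_left_mono[OF hv, of "exp (2 * \<delta>)"] by (simp flip: exp_add)
    \<comment> \<open>At \<open>v\<close> one \<open>\<delta>\<close> goes into the bound of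
      \<open>outer R v\<close> and two into removing \<open>h v\<close>; with the two from the
      coefficients this makes \<open>5 * \<delta>\<close>.\<close>
    have "\<bar>f v\<bar> * 1 \<le> (\<bar>poly P (v / R)\<bar> * exp \<delta>) * (exp (2 * \<delta>) * h v)"
      unfolding f_def abs_mult using Ev outer_pos[of R v] \<open>1 \<le> exp (2 * \<delta>) * h v\<close>
      by (intro mult_mono mult_left_mono) auto
    also have "\<dots> = exp (3 * \<delta>) * \<bar>poly P (v / R) * h v\<bar>"
    proof -
      have "exp (3 * \<delta>) = exp \<delta> * exp (2 * \<delta>)" by (simp flip: exp_add)
      moreover have "0 \<le> h v" using hv exp_ge_zero order_trans by blast
      ultimately show ?thesis by (simp add: abs_mult mult_ac)
    qed
    also have "\<dots> \<le> exp (3 * \<delta>) * (exp (2 * \<delta>) * (\<Sum>n\<in>?I. \<bar>f (u n)\<bar> * \<bar>sinc (\<tau> - of_int n)\<bar>))"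
      using 1 by (intro mult_left_mono) auto
    also have "\<dots> = exp (5 * \<delta>) * (\<Sum>n\<in>?I. \<bar>f (u n)\<bar> * \<bar>sinc (\<tau> - of_int n)\<bar>)"
      by (simp add: mult.assoc[symmetric] flip: exp_add)
    finally have "\<bar>f v\<bar> \<le> exp (5 * \<delta>) * (\<Sum>n\<in>?I. \<bar>f (u n)\<bar> * \<bar>sinc (\<tau> - of_int n)\<bar>)" by simp
    then have "\<bar>f v\<bar>\<^sup>2 \<le> (exp (5 * \<delta>) * (\<Sum>n\<in>?I. \<bar>f (u n)\<bar> * \<bar>sinc (\<tau> - of_int n)\<bar>))\<^sup>2"
      by (intro power_mono) auto
    also have "\<dots> = (exp (5 * \<delta>))\<^sup>2 * (\<Sum>n\<in>?I. \<bar>f (u n)\<bar> * \<bar>sinc (\<tau> - of_int n)\<bar>)\<^sup>2"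
      by (rule power_mult_distrib)
    also have "\<dots> \<le> (exp (5 * \<delta>))\<^sup>2 * ((\<Sum>n\<in>?I. \<bar>f (u n)\<bar>\<^sup>2) * (\<Sum>n\<in>?I. \<bar>sinc (\<tau> - of_int n)\<bar>\<^sup>2))"
      by (intro mult_left_mono Cauchy_Schwarz_ineq_sum) auto
    also have "\<dots> \<le> (exp (5 * \<delta>))\<^sup>2 * ((\<Sum>n\<in>?I. \<bar>f (u n)\<bar>\<^sup>2) * 1)"
      using sum_sinc_squared_le_1[of \<tau> "int M"] by (intro mult_left_mono sum_nonneg) auto
    finally show ?thesis by simp
  qed
  then show ?thesis by (simp add: f_def u_def)
qed

text \<open>The estimate at the nodes holds for every offset up to half a step. Integrating over the
  offset turns the sum of squares into an integral over at most the whole interval, and the length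
  of the period becomes the factor \<open>R / \<rho>\<close>.\<close>

lemma value_bound:
  assumes R: "0 < R" and \<rho>: "0 < \<rho>" and \<delta>: "0 \<le> \<delta>" "\<delta> \<le> 1 / 2"
    and m: "0 < m" "\<bar>eta R\<bar> * R \<le> real m" and deg: "degree P + m \<le> 2 * M"
    and nodes: "\<rho> * (real M + 1 / 2) \<le> R" and A: "0 \<le> A" "A + \<rho> \<le> \<rho> * real M"
    and cmp: "\<And>n u. \<bar>n\<bar> \<le> int M \<Longrightarrow> \<bar>u\<bar> \<le> R \<Longrightarrow> \<bar>u - \<rho> * of_int n\<bar> \<le> \<rho> / 2 \<Longrightarrow>
        tail p R u \<le> tail of_int M (of_int n) + \<delta>"
    and near: "\<And>x. \<bar>x\<bar> \<le> A / \<rho> + 1 \<Longrightarrow> tail of_int M x \<le> \<delta>"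
    and eta: "\<bar>eta R\<bar> * A \<le> \<delta>"
    and v: "\<bar>v\<bar> \<le> A"
  shows "(poly P (v / R) * outer R v)\<^sup>2 \<le> (exp (5 * \<delta>))\<^sup>2 * (R / \<rho>) * poly_weight.ip (zero_weight p R) P P"
proof -
  interpret W: poly_weight "zero_weight p R" using poly_weight_zero_weight R by simp
  let ?I = "{-int M..int M}"
  define g where "g t = poly (P * P) t * zero_weight p R t" for t
  define r where "r = \<rho> / R"
  define C where "C = (exp (5 * \<delta>))\<^sup>2"
  have r: "0 < r" using R \<rho> by (simp add: r_def)
  have C: "0 < C" by (simp add: C_def)
  have gi: "integrable lborel g" unfolding g_def by (rule W.integrable_poly)
  have gnn: "0 \<le> g t" for t using zero_weight_nonneg[of R t] R by (simp add: g_def)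
  \<comment> \<open>By the condition on the nodes, all of them stay in \<open>[-1, 1]\<close> for
    every offset, where the weight is \<open>outer\<close> squared.\<close>
  have geq: "g (\<theta> + of_int n * r) = (poly P ((R * \<theta> + of_int n * \<rho>) / R) * outer R (R * \<theta> + of_int n * \<rho>))\<^sup>2"
    if "\<theta> \<in> {-r/2..<r/2}" "n \<in> ?I" for \<theta> n
  proof -
    have "\<bar>\<theta>\<bar> \<le> r / 2" using that by auto
    moreover have "\<bar>of_int n * r\<bar> \<le> real M * r" using that r by (auto simp: abs_mult intro!: mult_right_mono)
    ultimately have "\<bar>\<theta> + of_int n * r\<bar> \<le> r / 2 + real M * r" by linarith
    also have "\<dots> = \<rho> * (real M + 1 / 2) / R"
      by (simp add: r_def distrib_left add_divide_distrib mult.commute)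
    also have "\<dots> \<le> 1" using nodes R by simp
    finally have "\<bar>\<theta> + of_int n * r\<bar> \<le> 1" .
    moreover have "R * (\<theta> + of_int n * r) = R * \<theta> + of_int n * \<rho>" using R by (simp add: r_def field_simps)
    moreover have "\<theta> + of_int n * r = (R * \<theta> + of_int n * \<rho>) / R" using R by (simp add: r_def field_simps)
    ultimately show ?thesis using R by (simp add: g_def zero_weight_eq power_mult_distrib power2_eq_square)
  qed
  have pt: "(poly P (v / R) * outer R v)\<^sup>2 \<le> C * (\<Sum>n\<in>?I. g (\<theta> + of_int n * r))" if "\<theta> \<in> {-r/2..<r/2}" for \<theta>
  proof -
    have "\<bar>\<theta>\<bar> \<le> r / 2" using that by auto
    then have "\<bar>R * \<theta>\<bar> \<le> \<rho> / 2" using R by (simp add: r_def abs_mult field_simps)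
    from value_bound_nodes[OF R \<rho> \<delta> m deg nodes A cmp near eta v this]
    show ?thesis using geq[OF that] unfolding C_def by simp
  qed
  let ?J = "{-(of_int (int M) + 1/2) * r..<(of_int (int M) + 1/2) * r}"
  have Ji: "integrable lborel (\<lambda>t. indicator ?J t * g t)"
    using integrable_mult_indicator[OF _ gi, of ?J] by simp
  have "r * (poly P (v / R) * outer R v)\<^sup>2 = (LINT \<theta>|lborel. indicator {-r/2..<r/2} \<theta> * (poly P (v / R) * outer R v)\<^sup>2)"
    using r by simp
  also have "\<dots> \<le> (LINT \<theta>|lborel. C * (indicator {-r/2..<r/2} \<theta> * (\<Sum>n\<in>?I. g (\<theta> + of_int n * r))))"
  proof (rule integral_mono)
    show "integrable lborel (\<lambda>\<theta>. indicator {-r/2..<r/2} \<theta> * (poly P (v / R) * outer R v)\<^sup>2)"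
      using r by (simp add: integrable_indicator_iff)
    show "integrable lborel (\<lambda>\<theta>. C * (indicator {-r/2..<r/2} \<theta> * (\<Sum>n\<in>?I. g (\<theta> + of_int n * r))))"
      by (intro integrable_mult_right integral_fold(2) gi r)
  qed (use pt in \<open>auto simp: indicator_def\<close>)
  also have "\<dots> = C * (LINT t|lborel. indicator ?J t * g t)"
    using integral_fold(1)[OF gi r, of "int M"] by simp
  also have "\<dots> \<le> C * (LINT t|lborel. g t)"
    using C gnn by (intro mult_left_mono integral_mono Ji gi) (auto simp: indicator_def)
  finally have "r * (poly P (v / R) * outer R v)\<^sup>2 \<le> C * W.ip P P" by (simp add: W.ip_def g_def)
  then show ?thesis using R \<rho> by (simp add: r_def C_def field_simps)
qed

text \<open>The sine product cut after \<open>M\<close> factors, centred at \<open>v\<close> with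
  spacing \<open>\<rho>\<close>, times the factor that cancels \<open>exp (- eta R * u)\<close> in
  \<open>outer\<close>. The argument of the polynomial is \<open>t = u / R\<close>.\<close>

definition test_poly :: "real \<Rightarrow> real \<Rightarrow> nat \<Rightarrow> nat \<Rightarrow> real \<Rightarrow> real poly" where
  "test_poly R \<rho> M m v =
     pcompose (\<Prod>j=1..M. [:1, 0, - 1 / (real j)\<^sup>2:]) [:- v / \<rho>, R / \<rho>:] * [:1, eta R * R / real m:] ^ m"

lemma degree_test_poly: "degree (test_poly R \<rho> M m v) \<le> 2 * M + m"
proof -
  have "degree (\<Prod>j=1..M. [:1, 0, - 1 / (real j)\<^sup>2:]) \<le> (\<Sum>j=1..M. degree [:1, 0, - 1 / (real j)\<^sup>2:])"
    using degree_prod_sum_le[of "{1..M}" "\<lambda>j. [:1, 0, - 1 / (real j)\<^sup>2:]"] by (simp add: o_def)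
  also have "\<dots> \<le> (\<Sum>j=1..M. 2)" by (intro sum_mono) auto
  finally have 1: "degree (\<Prod>j=1..M. [:1, 0, - 1 / (real j)\<^sup>2:]) \<le> 2 * M" by simp
  have "degree (pcompose (\<Prod>j=1..M. [:1, 0, - 1 / (real j)\<^sup>2:]) [:- v / \<rho>, R / \<rho>:])
      \<le> degree (\<Prod>j=1..M. [:1, 0, - 1 / (real j)\<^sup>2:]) * degree [:- v / \<rho>, R / \<rho>:]"
    by (rule degree_pcompose_le)
  also have "\<dots> \<le> (2 * M) * 1" using 1 by (intro mult_mono) auto
  finally have 2: "degree (pcompose (\<Prod>j=1..M. [:1, 0, - 1 / (real j)\<^sup>2:]) [:- v / \<rho>, R / \<rho>:]) \<le> 2 * M" by simp
  have "degree ([:1, eta R * R / real m:] ^ m) \<le> degree [:1, eta R * R / real m:] * m"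
    by (rule degree_power_le)
  also have "\<dots> \<le> m" by auto
  finally show ?thesis unfolding test_poly_def using 2 by (intro order_trans[OF degree_mult_le] add_mono)
qed

lemma poly_test_poly:
  assumes "R \<noteq> 0"
  shows "poly (test_poly R \<rho> M m v) (u / R) =
    (\<Prod>j=1..M. 1 - ((u - v) / \<rho>)\<^sup>2 / (real j)\<^sup>2) * (1 + eta R * u / real m) ^ m"
proof -
  have 1: "- v / \<rho> + u / R * (R / \<rho>) = (u - v) / \<rho>" using assms by (simp add: diff_divide_distrib)
  have 2: "u / R * (eta R * R / real m) = eta R * u / real m" using assms by simp
  have "poly (test_poly R \<rho> M m v) (u / R) =
    (\<Prod>j=1..M. poly [:1, 0, - 1 / (real j)\<^sup>2:] ((u - v) / \<rho>)) * (1 + u / R * (eta R * R / real m)) ^ m"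
    unfolding test_poly_def by (simp add: poly_pcompose poly_prod 1[simplified])
  moreover have "poly [:1, 0, - 1 / (real j)\<^sup>2:] x = 1 - x\<^sup>2 / (real j)\<^sup>2" for j x
    by (simp add: power2_eq_square)
  ultimately show ?thesis unfolding 2 by (simp only:)
qed

text \<open>The factors cut from the sine product reappear as a tail, so the deviation from sinc is
  the mismatch of the two tails and of \<open>(1 + x / m) ^ m\<close> with
  \<open>exp x\<close>.\<close>

lemma test_poly_value:
  assumes "R \<noteq> 0" "\<bar>(u - v) / \<rho>\<bar> \<le> real M"
  shows "poly (test_poly R \<rho> M m v) (u / R) * outer R u = sinc ((u - v) / \<rho>) *
     ((1 + eta R * u / real m) ^ m * exp (- (eta R * u)) * exp (tail of_int M ((u - v) / \<rho>) - tail p R u))"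
proof -
  have "(\<Prod>j=1..M. 1 - ((u - v) / \<rho>)\<^sup>2 / (real j)\<^sup>2) = sinc ((u - v) / \<rho>) * exp (tail of_int M ((u - v) / \<rho>))"
    using sinc_eq_prod_tail[OF assms(2)] by (simp add: exp_minus field_simps)
  then show ?thesis
    unfolding poly_test_poly[OF assms(1)] outer_def by (simp add: exp_diff exp_minus field_simps)
qed

text \<open>On the whole interval the correction factors multiply to at most
  \<open>exp \<delta>\<close>, which leaves the integral of a squared sinc.\<close>

lemma test_poly_norm:
  assumes R: "0 < R" and \<rho>: "0 < \<rho>" and m: "0 < m" "\<bar>eta R\<bar> * R \<le> real m"
    and cmp: "\<And>u. \<bar>u\<bar> \<le> R \<Longrightarrow> \<bar>(u - v) / \<rho>\<bar> \<le> real M \<and> tail of_int M ((u - v) / \<rho>) \<le> tail p R u + \<delta>"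
  shows "poly_weight.ip (zero_weight p R) (test_poly R \<rho> M m v) (test_poly R \<rho> M m v) \<le> (exp \<delta>)\<^sup>2 * (\<rho> / R)"
proof -
  interpret W: poly_weight "zero_weight p R" using poly_weight_zero_weight R by simp
  let ?P = "test_poly R \<rho> M m v"
  have "W.ip ?P ?P \<le> (LINT t|lborel. (exp \<delta>)\<^sup>2 * (indicator {-1..1} t * (sinc ((t - v / R) / (\<rho> / R)))\<^sup>2))"
    unfolding W.ip_def
  proof (rule integral_mono[OF W.integrable_poly])
    have "integrable lborel (\<lambda>t. indicator {-1..1} t *\<^sub>R (sinc ((t - v / R) / (\<rho> / R)))\<^sup>2)"
      by (rule borel_integrable_compact) (use R \<rho> in \<open>auto intro!: continuous_intros continuous_on_compose2[OF continuous_on_sinc[of UNIV]]\<close>)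
    then show "integrable lborel (\<lambda>t. (exp \<delta>)\<^sup>2 * (indicator {-1..1} t * (sinc ((t - v / R) / (\<rho> / R)))\<^sup>2))"
      by simp
    fix t
    show "poly (?P * ?P) t * zero_weight p R t \<le> (exp \<delta>)\<^sup>2 * (indicator {-1..1} t * (sinc ((t - v / R) / (\<rho> / R)))\<^sup>2)"
    proof (cases "\<bar>t\<bar> \<le> 1")
      case True
      define u where "u = R * t"
      have u: "\<bar>u\<bar> \<le> R" "t = u / R" using True R by (auto simp: u_def abs_mult mult_left_le)
      have s: "(t - v / R) / (\<rho> / R) = (u - v) / \<rho>" using R unfolding u(2) by (simp add: diff_divide_distrib[symmetric])
      have em: "\<bar>eta R * u\<bar> \<le> real m"
        using u(1) m(2) mult_left_mono[of "\<bar>u\<bar>" R "\<bar>eta R\<bar>"] by (simp add: abs_mult)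
      note b = one_plus_power_bounds[OF em m(1)]
      have "(1 + eta R * u / real m) ^ m * exp (- (eta R * u)) \<le> exp (eta R * u) * exp (- (eta R * u))"
        using b by (intro mult_right_mono) auto
      then have "(1 + eta R * u / real m) ^ m * exp (- (eta R * u)) \<le> 1" by (simp flip: exp_add)
      moreover have "exp (tail of_int M ((u - v) / \<rho>) - tail p R u) \<le> exp \<delta>" using cmp[OF u(1)] by simp
      ultimately have "(1 + eta R * u / real m) ^ m * exp (- (eta R * u)) * exp (tail of_int M ((u - v) / \<rho>) - tail p R u) \<le> 1 * exp \<delta>"
        using b(1) by (intro mult_mono) auto
      moreover have "0 \<le> (1 + eta R * u / real m) ^ m * exp (- (eta R * u)) * exp (tail of_int M ((u - v) / \<rho>) - tail p R u)"
        using b(1) by simp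
      ultimately have "\<bar>poly ?P (u / R) * outer R u\<bar> \<le> \<bar>sinc ((u - v) / \<rho>)\<bar> * (1 * exp \<delta>)"
        using R cmp[OF u(1)] by (subst test_poly_value) (auto simp: abs_mult intro!: mult_left_mono)
      then have "\<bar>poly ?P (u / R) * outer R u\<bar>\<^sup>2 \<le> (\<bar>sinc ((u - v) / \<rho>)\<bar> * (1 * exp \<delta>))\<^sup>2"
        by (intro power_mono) auto
      then have "(poly ?P t * outer R u)\<^sup>2 \<le> (exp \<delta>)\<^sup>2 * (sinc ((u - v) / \<rho>))\<^sup>2"
        by (simp add: power_mult_distrib u(2) mult.commute)
      moreover have "poly (?P * ?P) t * zero_weight p R t = (poly ?P t * outer R u)\<^sup>2"
        using True R by (simp add: zero_weight_eq u_def power2_eq_square)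
      ultimately show ?thesis unfolding s using True by (simp add: indicator_def abs_le_iff)
    next
      case False
      then show ?thesis using R by (simp add: zero_weight_eq)
    qed
  qed
  also have "\<dots> = (exp \<delta>)\<^sup>2 * (LINT t|lborel. indicator {-1..1} t * (sinc ((t - v / R) / (\<rho> / R)))\<^sup>2)"
    by (rule integral_mult_right_zero)
  also have "\<dots> \<le> (exp \<delta>)\<^sup>2 * (\<rho> / R)"
    by (intro mult_left_mono integral_sinc_squared_le divide_pos_pos R \<rho>) auto
  finally show ?thesis .
qed

lemma test_poly_near_sinc:
  assumes R: "0 < R" and m: "0 < m" "\<bar>eta R\<bar> * A \<le> real m" and \<delta>: "0 \<le> \<delta>" "\<delta> \<le> 1 / 2"
    and cmp: "\<bar>(u - v) / \<rho>\<bar> \<le> real M" "tail of_int M ((u - v) / \<rho>) \<le> tail p R u + \<delta>"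
    and u: "\<bar>u\<bar> \<le> A" "\<bar>u\<bar> \<le> R" and eta: "\<bar>eta R\<bar> * A \<le> \<delta>" and near: "tail p R u \<le> \<delta>"
  shows "\<bar>poly (test_poly R \<rho> M m v) (u / R) * outer R u - sinc ((u - v) / \<rho>)\<bar> \<le> exp (4 * \<delta>) - 1"
proof -
  define G where "G = (1 + eta R * u / real m) ^ m * exp (- (eta R * u)) * exp (tail of_int M ((u - v) / \<rho>) - tail p R u)"
  have e: "\<bar>eta R * u\<bar> \<le> \<bar>eta R\<bar> * A" using u(1) by (simp add: abs_mult mult_left_mono)
  then have em: "\<bar>eta R * u\<bar> \<le> real m" "\<bar>eta R * u\<bar> \<le> \<delta>" using m eta by auto
  note b = one_plus_power_bounds[OF em(1) m(1)]
  have "(1 + eta R * u / real m) ^ m * exp (- (eta R * u)) \<le> exp (eta R * u) * exp (- (eta R * u))"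
    using b by (intro mult_right_mono) auto
  then have "(1 + eta R * u / real m) ^ m * exp (- (eta R * u)) \<le> 1" by (simp flip: exp_add)
  then have "G \<le> 1 * exp \<delta>" unfolding G_def using b(1) cmp by (intro mult_mono) auto
  also have "\<dots> \<le> exp (4 * \<delta>)" using \<delta> by simp
  finally have up: "G \<le> exp (4 * \<delta>)" .
  have lo1: "exp (- 2 * \<delta>) \<le> (1 + eta R * u / real m) ^ m"
    using exp_le_one_minus[OF \<delta>] b(3) em(2) by linarith
  \<comment> \<open>Two \<open>\<delta>\<close> are lost to Bernoulli, one to
    \<open>exp (- (eta R * u))\<close> and one to the tail of \<open>p\<close>; the integer tail
    only helps.\<close>
  have "exp (- 4 * \<delta>) = exp (- 2 * \<delta>) * exp (- \<delta>) * exp (- \<delta>)" by (simp flip: exp_add)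
  also have "\<dots> \<le> G"
    unfolding G_def using lo1 em(2) near ints.tail_nonneg[OF cmp(1)] b(1) by (intro mult_mono) auto
  finally have lo: "exp (- 4 * \<delta>) \<le> G" .
  have "2 \<le> exp (4 * \<delta>) + exp (- 4 * \<delta>)"
    using exp_ge_add_one_self[of "4 * \<delta>"] exp_ge_add_one_self[of "- 4 * \<delta>"] by linarith
  then have G: "\<bar>G - 1\<bar> \<le> exp (4 * \<delta>) - 1" using up lo by linarith
  have "poly (test_poly R \<rho> M m v) (u / R) * outer R u - sinc ((u - v) / \<rho>) = sinc ((u - v) / \<rho>) * (G - 1)"
    using test_poly_value[OF _ cmp(1), of R m] R by (simp add: G_def algebra_simps)
  then have "\<bar>poly (test_poly R \<rho> M m v) (u / R) * outer R u - sinc ((u - v) / \<rho>)\<bar> \<le> 1 * (exp (4 * \<delta>) - 1)"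
    by (simp only: abs_mult) (intro mult_mono G abs_sinc_le_1, auto)
  then show ?thesis by simp
qed

end

subsection \<open>The scaling limit\<close>

context almost_integers
begin

text \<open>\<open>\<sigma>\<close> governs every loss at once. The value bound uses spacing
  \<open>1 / (1 + \<sigma>) ^ 4\<close> and the test function the reciprocal spacing;
  \<open>\<beta>\<close> is the constant of the former and dominates the norm constant of the
  latter.\<close>

lemma kernel_near_sinc_scaled:
  fixes N :: "real \<Rightarrow> int" and \<sigma> A :: real
  assumes N: "((\<lambda>R. of_int (N R) / R) \<longlongrightarrow> 2) at_top"
    and \<sigma>: "0 < \<sigma>" "\<sigma> \<le> 1 / 2" and A: "0 < A"
    and \<beta>: "\<beta> = (exp (5 * \<sigma>))\<^sup>2 * (1 + \<sigma>) ^ 4"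
  shows "\<forall>\<^sub>F R in at_top. \<forall>u v. \<bar>u\<bar> \<le> A \<longrightarrow> \<bar>v\<bar> \<le> A \<longrightarrow>
     \<bar>poly_kernel (nat (N R)) (zero_weight p R) (u / R) (v / R) / R - sinc ((u - v) / (1 + \<sigma>) ^ 4)\<bar>
       \<le> sqrt (4 * \<beta> * (\<beta> - 1)) + (\<beta> - 1)"
proof -
  define c where "c = (1 + \<sigma>) ^ 4"
  define \<rho> where "\<rho> = 1 / c"
  have c1: "1 < c" using \<sigma> by (simp add: c_def)
  have \<rho>: "0 < \<rho>" "\<rho> = 1 / (1 + \<sigma>) ^ 4" using c1 by (auto simp: \<rho>_def c_def)
  have \<rho>c: "\<rho> * (1 + \<sigma>) \<le> 1"
  proof -
    have "(1 + \<sigma>) ^ 1 \<le> c" unfolding c_def using \<sigma> by (intro power_increasing) auto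
    then show ?thesis using c1 by (simp add: \<rho>_def)
  qed
  obtain T where T: "\<And>S x. T \<le> S \<Longrightarrow> \<bar>x\<bar> \<le> A / \<rho> + 1 \<Longrightarrow> tail of_int S x \<le> \<sigma>"
    using ints.tail_eventually_le[OF \<sigma>(1), of "A / \<rho> + 1"] by (auto simp: eventually_at_top_linorder)
  have etaA: "\<forall>\<^sub>F R in at_top. \<bar>eta R\<bar> < min (\<sigma> / 4) (\<sigma> / A)"
    using tendstoD[OF eta_tendsto_0, of "min (\<sigma> / 4) (\<sigma> / A)"] \<sigma> A by simp
  have N_up: "\<forall>\<^sub>F R in at_top. of_int (N R) / R < 2 + \<sigma> / 4"
    using \<sigma> by (intro order_tendstoD(2)[OF N]) auto
  have N_lo: "\<forall>\<^sub>F R in at_top. 2 - \<sigma> / 4 < of_int (N R) / R"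
    using \<sigma> by (intro order_tendstoD(1)[OF N]) auto
  have \<sigma>1: "\<sigma> \<le> 1" using \<sigma> by simp
  \<comment> \<open>\<open>R > 10 / \<sigma>\<close> makes \<open>\<sigma> * R / 2\<close> exceed 5,
    which covers the rounding losses in both degree counts.\<close>
  show ?thesis
    using tail_le_tail_int[OF \<sigma>(1) \<sigma>(1) \<rho>(2)] tail_int_le_tail[OF \<sigma>(1) \<sigma>(1) \<sigma>1, of A]
      tail_eventually_le[OF \<sigma>(1), of A] etaA N_up N_lo
      eventually_ge_at_top[of "A / \<rho> + 3"] eventually_ge_at_top[of "T + 2"]
      eventually_gt_at_top[of "10 / \<sigma>"] eventually_ge_at_top[of "A + 1"]
  proof eventually_elim
    case (elim R)
    have R: "0 < R" "A \<le> R" "10 < \<sigma> * R" using elim A \<sigma> by (auto simp: field_simps)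
    have N_bounds: "of_int (N R) < 2 * R + \<sigma> * R / 4" "2 * R - \<sigma> * R / 4 < of_int (N R)"
      using elim(5,6) R by (auto simp: field_simps)
    define n where "n = nat (N R)"
    have n: "real n = of_int (N R)"
    proof -
      have "\<sigma> * R \<le> 1 * R" using \<sigma> R by (intro mult_right_mono) auto
      then have "0 < real_of_int (N R)" using N_bounds(2) R by linarith
      then show ?thesis by (simp add: n_def)
    qed
    define m where "m = nat \<lceil>\<sigma> * R / 4\<rceil>"
    have m_ge: "\<sigma> * R / 4 \<le> real m" unfolding m_def by linarith
    have m_le: "real m \<le> \<sigma> * R / 4 + 1" unfolding m_def using R by linarith
    have m0: "0 < m" using m_ge R by (cases "m = 0") auto
    have eR: "\<bar>eta R\<bar> * R \<le> real m"
    proof -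
      have "\<bar>eta R\<bar> * R \<le> \<sigma> / 4 * R" using elim(4) R by (intro mult_right_mono) auto
      then show ?thesis using m_ge by simp
    qed
    have eA: "\<bar>eta R\<bar> * A \<le> \<sigma>"
    proof -
      have "\<bar>eta R\<bar> * A \<le> \<sigma> / A * A" using elim(4) A by (intro mult_right_mono) auto
      then show ?thesis using A by simp
    qed
    have eAm: "\<bar>eta R\<bar> * A \<le> real m"
      using eR mult_left_mono[OF R(2), of "\<bar>eta R\<bar>"] by simp
    interpret W: poly_weight "zero_weight p R" using poly_weight_zero_weight R by simp
    \<comment> \<open>About \<open>2 * \<sigma> * R\<close> more nodes than \<open>2 * R\<close>; a
      quarter of the surplus pays for \<open>m\<close> and for the fluctuation of
      \<open>N R\<close>.\<close>
    define M where "M = nat (\<lfloor>(1 + \<sigma>) * R\<rfloor> - 1)"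
    have Mf: "real M = of_int \<lfloor>(1 + \<sigma>) * R\<rfloor> - 1"
    proof -
      have "1 \<le> R" using R(3) \<sigma> elim(10) A by simp
      then have "1 \<le> (1 + \<sigma>) * R" using mult_mono[of 1 "1 + \<sigma>" 1 R] \<sigma> by simp
      then show ?thesis by (simp add: M_def le_floor_iff)
    qed
    have M: "real M + 1 \<le> (1 + \<sigma>) * R" "(1 + \<sigma>) * R - 2 < real M" unfolding Mf by linarith+
    have MR: "R + \<sigma> * R - 2 < real M" using M by (simp add: algebra_simps)
    have near: "tail of_int M x \<le> \<sigma>" if "\<bar>x\<bar> \<le> A / \<rho> + 1" for x
      using T[OF _ that, of "real M"] MR elim(8) R by simp
    have bound: "(poly q z)\<^sup>2 * zero_weight p R z \<le> R * \<beta> * W.ip q q"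
      if q: "degree q < n" and z: "z \<in> {u / R, v / R}" "\<bar>u\<bar> \<le> A" "\<bar>v\<bar> \<le> A" for q z u v
    proof -
      obtain x where x: "z = x / R" "\<bar>x\<bar> \<le> A" using z by blast
      have deg: "degree q + m \<le> 2 * M"
      proof -
        have "real (degree q) + 1 \<le> real n" using q by linarith
        then have "real (degree q) + real m \<le> real (2 * M)"
          using n N_bounds m_le MR R by simp
        then show ?thesis by linarith
      qed
      have "\<rho> * (real M + 1 / 2) \<le> \<rho> * ((1 + \<sigma>) * R)" using M \<rho> by (intro mult_left_mono) auto
      also have "\<dots> = (\<rho> * (1 + \<sigma>)) * R" by simp
      also have "\<dots> \<le> 1 * R" using \<rho>c R by (intro mult_right_mono) auto
      finally have nodes: "\<rho> * (real M + 1 / 2) \<le> R" by simp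
      have "A / \<rho> + 1 \<le> real M" using MR elim(7) R by simp
      then have AM: "A + \<rho> \<le> \<rho> * real M" using \<rho>(1) by (simp add: field_simps)
      have e: "R * \<beta> = (exp (5 * \<sigma>))\<^sup>2 * (R / \<rho>)" by (simp add: \<beta> \<rho>_def c_def)
      have "(poly q (x / R) * outer R x)\<^sup>2 \<le> R * \<beta> * W.ip q q"
        unfolding e by (rule value_bound[where m = m and M = M and A = A])
          (use R \<rho> \<sigma> m0 eR deg nodes AM A near eA x elim(1) M in auto)
      moreover have "\<bar>x / R\<bar> \<le> 1" using x R by (simp add: divide_le_eq_1)
      ultimately show ?thesis using R x by (simp add: zero_weight_eq power_mult_distrib)
    qed
    \<comment> \<open>The least value allowed by the comparison of tails. It leaves the degree
      \<open>2 * L\<close> short of \<open>2 * R\<close> by about \<open>\<sigma> * R\<close> or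
      more, enough for \<open>m\<close> and the fluctuation of \<open>N R\<close>.\<close>
    define L where "L = nat \<lceil>(R + 1) / (1 + \<sigma>)\<rceil>"
    have L: "R + 1 \<le> (1 + \<sigma>) * real L"
    proof -
      have "(R + 1) / (1 + \<sigma>) \<le> real L" unfolding L_def by linarith
      then show ?thesis using \<sigma> by (simp add: field_simps)
    qed
    have L2: "2 * L + m < n"
    proof -
      have "0 \<le> (R + 1) / (1 + \<sigma>)" using R \<sigma> by simp
      then have "real L \<le> (R + 1) / (1 + \<sigma>) + 1" unfolding L_def by linarith
      also have "(R + 1) / (1 + \<sigma>) \<le> (R + 1) * (1 - \<sigma> / 2)"
      proof -
        have "\<sigma> * \<sigma> \<le> \<sigma> * 1" using \<sigma> by (intro mult_left_mono) auto
        then have "1 \<le> (1 - \<sigma> / 2) * (1 + \<sigma>)" by (simp add: algebra_simps)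
        then have "1 / (1 + \<sigma>) \<le> 1 - \<sigma> / 2" using \<sigma> by (simp add: divide_le_eq)
        then have "(R + 1) * (1 / (1 + \<sigma>)) \<le> (R + 1) * (1 - \<sigma> / 2)" using R by (intro mult_left_mono) auto
        then show ?thesis by simp
      qed
      also have "(R + 1) * (1 - \<sigma> / 2) = R + 1 - \<sigma> * R / 2 - \<sigma> / 2" by (simp add: field_simps)
      finally have "2 * real L + real m < real n" using m_le N_bounds(2) n R(3) \<sigma>(1) by linarith
      then show ?thesis by linarith
    qed
    have \<beta>1: "exp (4 * \<sigma>) \<le> \<beta>" "(exp \<sigma>)\<^sup>2 * c \<le> \<beta>" "1 \<le> \<beta>"
    proof -
      have e: "(exp (5 * \<sigma>))\<^sup>2 = exp (10 * \<sigma>)" "(exp \<sigma>)\<^sup>2 = exp (2 * \<sigma>)" by (simp_all flip: exp_of_nat_mult exp_double)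
      have "exp (4 * \<sigma>) * 1 \<le> \<beta>" unfolding \<beta> e c_def[symmetric] using \<sigma> c1 by (intro mult_mono) auto
      then show "exp (4 * \<sigma>) \<le> \<beta>" by simp
      moreover have "1 \<le> exp (4 * \<sigma>)" using \<sigma> by simp
      ultimately show "1 \<le> \<beta>" by linarith
      show "(exp \<sigma>)\<^sup>2 * c \<le> \<beta>" unfolding \<beta> e c_def[symmetric] using \<sigma> c1 by (intro mult_right_mono) auto
    qed
    show ?case
    proof (intro allI impI)
      fix u v :: real assume u: "\<bar>u\<bar> \<le> A" and v: "\<bar>v\<bar> \<le> A"
      let ?P = "test_poly R c L m v"
      define F where "F x = poly ?P (x / R) * outer R x" for x
      have cmp: "\<bar>(x - v) / c\<bar> \<le> real L \<and> tail of_int L ((x - v) / c) \<le> tail p R x + \<sigma>" if "\<bar>x\<bar> \<le> R" for x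
        using elim(2) L that v unfolding c_def by blast
      have near_sinc: "\<bar>F x - sinc ((x - v) / c)\<bar> \<le> \<beta> - 1" if x: "\<bar>x\<bar> \<le> A" for x
      proof -
        have "\<bar>x\<bar> \<le> R" using x R by simp
        then have "\<bar>F x - sinc ((x - v) / c)\<bar> \<le> exp (4 * \<sigma>) - 1"
          unfolding F_def
          by (intro test_poly_near_sinc[where A = A]) (use R m0 eAm \<sigma> cmp x eA elim(3) in auto)
        then show ?thesis using \<beta>1 by simp
      qed
      have normP: "W.ip ?P ?P \<le> (exp \<sigma>)\<^sup>2 * (c / R)"
        by (rule test_poly_norm) (use R m0 eR cmp c1 in auto)
      \<comment> \<open>The kernel is of size \<open>R\<close> on the diagonal and
        \<open>F v\<close> is close to 1, so the almost extremal element is \<open>R\<close> times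
        the test polynomial.\<close>
      have "W.ip (smult R ?P) (smult R ?P) = R * R * W.ip ?P ?P"
        by (simp add: W.ip_smult_left W.ip_smult_right)
      also have "\<dots> \<le> R * R * ((exp \<sigma>)\<^sup>2 * (c / R))" using normP R by (intro mult_left_mono) auto
      also have "\<dots> = R * ((exp \<sigma>)\<^sup>2 * c)" using R by simp
      also have "\<dots> \<le> R * \<beta>" using \<beta>1 R by (intro mult_left_mono) auto
      finally have norm: "W.ip (smult R ?P) (smult R ?P) \<le> R * \<beta>" .
      have deg: "degree (smult R ?P) < n"
        using degree_smult_le[of R ?P] degree_test_poly[of R c L m v] L2 by linarith
      have x1: "\<bar>u / R\<bar> \<le> 1" "\<bar>v / R\<bar> \<le> 1" using u v R by (auto simp: divide_le_eq_1)
      have sq: "sqrt (zero_weight p R (u / R)) = outer R u" "sqrt (zero_weight p R (v / R)) = outer R v"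
        using sqrt_zero_weight[of R "u / R"] sqrt_zero_weight[of R "v / R"] x1 R by auto
      define k where "k = poly_kernel n (zero_weight p R) (u / R) (v / R)"
      have "(k - R * F u)\<^sup>2 \<le> R * \<beta> * (R * \<beta> - 2 * (R * F v) + R * \<beta>)"
      proof -
        have "(k - outer R u * poly (smult R ?P) (u / R))\<^sup>2
            \<le> R * \<beta> * (R * \<beta> - 2 * outer R v * poly (smult R ?P) (v / R) + R * \<beta>)"
          unfolding k_def sq[symmetric]
        proof (rule W.poly_kernel_approx[OF deg _ _ _ norm])
          show "(poly q z)\<^sup>2 * zero_weight p R z \<le> R * \<beta> * W.ip q q"
            if "degree q < n" "z \<in> {u / R, v / R}" for q z
            using bound[OF that u v] .
        qed (use R zero_weight_nonneg in auto)
        then show ?thesis by (simp add: F_def mult_ac)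
      qed
      also have "\<dots> = R\<^sup>2 * (\<beta> * (2 * (\<beta> - F v)))" by (simp add: power2_eq_square algebra_simps)
      \<comment> \<open>As \<open>sinc 0 = 1\<close>, \<open>F v\<close> is at least
        \<open>1 - (\<beta> - 1)\<close>, so its distance below \<open>\<beta>\<close> is at most
        \<open>2 * (\<beta> - 1)\<close>.\<close>
      also have "\<dots> \<le> R\<^sup>2 * (\<beta> * (2 * (2 * (\<beta> - 1))))"
        using near_sinc[OF v] \<beta>1 by (intro mult_left_mono) (auto simp: sinc_def)
      finally have "(k - R * F u)\<^sup>2 / R\<^sup>2 \<le> 4 * \<beta> * (\<beta> - 1)" using R by (simp add: divide_le_eq mult_ac)
      moreover have "(k - R * F u)\<^sup>2 / R\<^sup>2 = (k / R - F u)\<^sup>2" using R by (simp add: diff_divide_distrib flip: power_divide)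
      ultimately have "\<bar>k / R - F u\<bar> \<le> sqrt (4 * \<beta> * (\<beta> - 1))" by (simp add: real_le_rsqrt)
      then show "\<bar>poly_kernel (nat (N R)) (zero_weight p R) (u / R) (v / R) / R - sinc ((u - v) / (1 + \<sigma>) ^ 4)\<bar>
          \<le> sqrt (4 * \<beta> * (\<beta> - 1)) + (\<beta> - 1)"
        using near_sinc[OF u] unfolding k_def n_def c_def[symmetric] by linarith
    qed
  qed
qed

end

text \<open>Uniform continuity on a compact interval, used twice: to remove the spacing from the
  limit kernel and to pass from the scale \<open>R\<close> to \<open>N / 2\<close>.\<close>

lemma sinc_scale:
  assumes "0 < \<epsilon>" "0 < D"
  obtains \<eta> where "0 < \<eta>" "\<And>l d. \<bar>l - 1\<bar> < \<eta> \<Longrightarrow> \<bar>d\<bar> \<le> D \<Longrightarrow> \<bar>sinc (l * d) - sinc d\<bar> < \<epsilon>"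
proof -
  have "uniformly_continuous_on {- 2 * D..2 * D} sinc"
    by (intro compact_uniformly_continuous continuous_on_sinc) simp
  then obtain \<eta> where \<eta>: "0 < \<eta>" and close: "\<And>x y. x \<in> {- 2 * D..2 * D} \<Longrightarrow> y \<in> {- 2 * D..2 * D} \<Longrightarrow>
      dist y x < \<eta> \<Longrightarrow> dist (sinc y) (sinc x) < \<epsilon>"
    using assms(1) unfolding uniformly_continuous_on_def by metis
  have "\<bar>sinc (l * d) - sinc d\<bar> < \<epsilon>" if l: "\<bar>l - 1\<bar> < min 1 (\<eta> / D)" and d: "\<bar>d\<bar> \<le> D" for l d
  proof -
    have "\<bar>l * d - d\<bar> = \<bar>l - 1\<bar> * \<bar>d\<bar>" by (simp add: algebra_simps flip: abs_mult)
    also have "\<dots> \<le> \<bar>l - 1\<bar> * D" using d by (intro mult_left_mono) auto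
    finally have b: "\<bar>l * d - d\<bar> \<le> \<bar>l - 1\<bar> * D" .
    have "\<bar>l - 1\<bar> * D < \<eta>" using l assms by (simp add: pos_less_divide_eq)
    moreover have "\<bar>l - 1\<bar> * D \<le> 1 * D" using l assms by (intro mult_right_mono) auto
    ultimately have "\<bar>l * d - d\<bar> < \<eta>" "\<bar>l * d\<bar> \<le> 2 * D" using b d by linarith+
    moreover have "\<bar>d\<bar> \<le> 2 * D" using d assms by linarith
    ultimately show ?thesis using close[of d "l * d"] by (auto simp: dist_real_def abs_le_iff)
  qed
  moreover have "0 < min 1 (\<eta> / D)" using \<eta> assms by simp
  ultimately show thesis using that by blast
qed

text \<open>For fixed \<open>\<sigma>\<close> the error bound does not improve as \<open>R\<close>
  grows, but it tends to 0 with \<open>\<sigma>\<close> because \<open>\<beta>\<close> tends to 1;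
  so \<open>\<sigma>\<close> is fixed before \<open>R\<close>.\<close>

lemma (in almost_integers) kernel_near_sinc:
  fixes N :: "real \<Rightarrow> int"
  assumes N: "((\<lambda>R. of_int (N R) / R) \<longlongrightarrow> 2) at_top" and A: "0 < A" and \<epsilon>: "0 < \<epsilon>"
  shows "\<forall>\<^sub>F R in at_top. \<forall>u v. \<bar>u\<bar> \<le> A \<longrightarrow> \<bar>v\<bar> \<le> A \<longrightarrow>
     \<bar>poly_kernel (nat (N R)) (zero_weight p R) (u / R) (v / R) / R - sinc (u - v)\<bar> < \<epsilon>"
proof -
  obtain \<eta> where \<eta>: "0 < \<eta>" "\<And>l d. \<bar>l - 1\<bar> < \<eta> \<Longrightarrow> \<bar>d\<bar> \<le> 2 * A \<Longrightarrow> \<bar>sinc (l * d) - sinc d\<bar> < \<epsilon> / 2"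
    using sinc_scale[of "\<epsilon> / 2" "2 * A"] \<epsilon> A by auto
  define \<beta> where "\<beta> \<sigma> = (exp (5 * \<sigma>))\<^sup>2 * (1 + \<sigma>) ^ 4" for \<sigma> :: real
  have "((\<lambda>\<sigma>. sqrt (4 * \<beta> \<sigma> * (\<beta> \<sigma> - 1)) + (\<beta> \<sigma> - 1)) \<longlongrightarrow> sqrt (4 * \<beta> 0 * (\<beta> 0 - 1)) + (\<beta> 0 - 1)) (at_right 0)"
    unfolding \<beta>_def by (intro tendsto_intros)
  then have "\<forall>\<^sub>F \<sigma> in at_right 0. sqrt (4 * \<beta> \<sigma> * (\<beta> \<sigma> - 1)) + (\<beta> \<sigma> - 1) < \<epsilon> / 2"
    using \<epsilon> by (intro order_tendstoD(2)) (auto simp: \<beta>_def)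
  moreover have "((\<lambda>\<sigma>::real. 1 / (1 + \<sigma>) ^ 4) \<longlongrightarrow> 1 / (1 + 0) ^ 4) (at_right 0)"
    by (intro tendsto_intros) auto
  then have "\<forall>\<^sub>F \<sigma>::real in at_right 0. \<bar>1 / (1 + \<sigma>) ^ 4 - 1\<bar> < \<eta>"
    using tendstoD[OF _ \<eta>(1)] by (force simp: dist_real_def)
  moreover have "\<forall>\<^sub>F \<sigma>::real in at_right 0. 0 < \<sigma>" by (rule eventually_at_right_less)
  moreover have "\<forall>\<^sub>F \<sigma>::real in at_right 0. \<sigma> < 1 / 2"
    by (rule order_tendstoD(2)[OF tendsto_ident_at]) simp
  ultimately have "\<forall>\<^sub>F \<sigma> in at_right 0. sqrt (4 * \<beta> \<sigma> * (\<beta> \<sigma> - 1)) + (\<beta> \<sigma> - 1) < \<epsilon> / 2 \<and>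
      \<bar>1 / (1 + \<sigma>) ^ 4 - 1\<bar> < \<eta> \<and> 0 < \<sigma> \<and> \<sigma> < 1 / 2"
    by (intro eventually_conj)
  then obtain \<sigma> where \<sigma>: "sqrt (4 * \<beta> \<sigma> * (\<beta> \<sigma> - 1)) + (\<beta> \<sigma> - 1) < \<epsilon> / 2" "\<bar>1 / (1 + \<sigma>) ^ 4 - 1\<bar> < \<eta>" "0 < \<sigma>" "\<sigma> < 1 / 2"
    using eventually_happens'[OF trivial_limit_at_right_real] by blast
  have "\<sigma> \<le> 1 / 2" using \<sigma> by simp
  from kernel_near_sinc_scaled[OF N \<sigma>(3) this A \<beta>_def]
  show ?thesis
  proof eventually_elim
    case (elim R)
    show ?case
    proof (intro allI impI)
      fix u v :: real assume uv: "\<bar>u\<bar> \<le> A" "\<bar>v\<bar> \<le> A"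
      have "\<bar>u - v\<bar> \<le> 2 * A" using uv by linarith
      from \<eta>(2)[OF \<sigma>(2) this] have "\<bar>sinc ((u - v) / (1 + \<sigma>) ^ 4) - sinc (u - v)\<bar> < \<epsilon> / 2" by simp
      moreover have "\<bar>poly_kernel (nat (N R)) (zero_weight p R) (u / R) (v / R) / R - sinc ((u - v) / (1 + \<sigma>) ^ 4)\<bar> < \<epsilon> / 2"
        using elim uv \<sigma>(1) by (meson le_less_trans)
      ultimately show "\<bar>poly_kernel (nat (N R)) (zero_weight p R) (u / R) (v / R) / R - sinc (u - v)\<bar> < \<epsilon>"
        by linarith
    qed
  qed
qed

theorem theorem1p4:
  fixes p :: "int \<Rightarrow> real" and N :: "real \<Rightarrow> int"
  assumes "strict_mono p"
    and "p (- 1) < 0" and "0 \<le> p 0"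
    and "\<exists>L. ((\<lambda>S::real. \<Sum>n\<in>{n. 0 < \<bar>p n\<bar> \<and> \<bar>p n\<bar> < S}. 1 / p n) \<longlongrightarrow> L) at_top"
    and "((\<lambda>n. p n / of_int n) \<longlongrightarrow> 1) at_top"
    and "((\<lambda>n. p n / of_int n) \<longlongrightarrow> 1) at_bot"
    and "((\<lambda>R. of_int (N R) / R) \<longlongrightarrow> 2) at_top"
  shows "\<forall>C::real set. compact C \<longrightarrow>
    uniform_limit (C \<times> C)
      (\<lambda>R (x, y). 2 / of_int (N R) *
         poly_kernel (nat (N R)) (zero_weight p R) (2 * x / of_int (N R)) (2 * y / of_int (N R)))
      (\<lambda>(x, y). sine_kernel x y) at_top"
proof (intro allI impI)
  fix C :: "real set" assume "compact C"
  then obtain A where A: "0 < A" "\<And>x. x \<in> C \<Longrightarrow> \<bar>x\<bar> \<le> A"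
    by (metis bounded_pos compact_imp_bounded real_norm_def)
  interpret almost_integers p using assms(1-6) by unfold_locales
  have "((\<lambda>R. 2 / (of_int (N R) / R)) \<longlongrightarrow> 2 / 2) at_top" by (intro tendsto_intros assms) simp
  then have scale: "((\<lambda>R. 2 * R / of_int (N R)) \<longlongrightarrow> 1) at_top" by simp
  show "uniform_limit (C \<times> C)
      (\<lambda>R (x, y). 2 / of_int (N R) *
         poly_kernel (nat (N R)) (zero_weight p R) (2 * x / of_int (N R)) (2 * y / of_int (N R)))
      (\<lambda>(x, y). sine_kernel x y) at_top"
  proof (rule uniform_limitI)
    fix \<epsilon> :: real assume \<epsilon>: "0 < \<epsilon>"
    obtain \<eta> where \<eta>: "0 < \<eta>" "\<And>l d. \<bar>l - 1\<bar> < \<eta> \<Longrightarrow> \<bar>d\<bar> \<le> 2 * A \<Longrightarrow> \<bar>sinc (l * d) - sinc d\<bar> < \<epsilon> / 8"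
      using sinc_scale[of "\<epsilon> / 8" "2 * A"] \<epsilon> A by auto
    have "\<forall>\<^sub>F R in at_top. \<bar>2 * R / of_int (N R) - 1\<bar> < min \<eta> (min 1 (\<epsilon> / 4))"
      using tendstoD[OF scale, of "min \<eta> (min 1 (\<epsilon> / 4))"] \<eta> \<epsilon> by (simp add: dist_real_def)
    moreover have "\<forall>\<^sub>F R in at_top. \<forall>u v. \<bar>u\<bar> \<le> 2 * A \<longrightarrow> \<bar>v\<bar> \<le> 2 * A \<longrightarrow>
        \<bar>poly_kernel (nat (N R)) (zero_weight p R) (u / R) (v / R) / R - sinc (u - v)\<bar> < \<epsilon> / 8"
      by (rule kernel_near_sinc) (use A \<epsilon> assms in auto)
    ultimately show "\<forall>\<^sub>F R in at_top. \<forall>z\<in>C \<times> C. dist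
        (case z of (x, y) \<Rightarrow> 2 / of_int (N R) * poly_kernel (nat (N R)) (zero_weight p R) (2 * x / of_int (N R)) (2 * y / of_int (N R)))
        (case z of (x, y) \<Rightarrow> sine_kernel x y) < \<epsilon>"
      using eventually_gt_at_top[of 0]
    proof eventually_elim
      case (elim R)
      \<comment> \<open>Writing \<open>2 * x / N\<close> as \<open>l * x / R\<close> reduces the
        claim to the scale \<open>R\<close>, with the prefactor \<open>2 / N\<close> equal to
        \<open>l / R\<close>. Since \<open>\<bar>l\<bar> <= 2\<close>, the moved points stay within
        \<open>2 * A\<close>.\<close>
      define l where "l = 2 * R / of_int (N R)"
      have l: "\<bar>l - 1\<bar> < \<eta>" "\<bar>l - 1\<bar> < 1" "\<bar>l - 1\<bar> < \<epsilon> / 4" using elim by (auto simp: l_def)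
      then have l2: "\<bar>l\<bar> \<le> 2" by linarith
      show ?case
      proof (intro ballI, clarify)
        fix x y assume xy: "x \<in> C" "y \<in> C"
        define k where "k = poly_kernel (nat (N R)) (zero_weight p R) (l * x / R) (l * y / R)"
        have lA: "\<bar>l * z\<bar> \<le> 2 * A" if "z \<in> C" for z
          using mult_mono[OF l2 A(2)[OF that]] A by (simp add: abs_mult)
        have xy2: "\<bar>x - y\<bar> \<le> 2 * A" using A(2)[OF xy(1)] A(2)[OF xy(2)] by linarith
        have "\<bar>k / R - sinc (l * x - l * y)\<bar> < \<epsilon> / 8" using elim(2) lA[OF xy(1)] lA[OF xy(2)] unfolding k_def by blast
        moreover have "\<bar>sinc (l * x - l * y) - sinc (x - y)\<bar> < \<epsilon> / 8"
          using \<eta>(2)[OF l(1) xy2] by (simp add: right_diff_distrib)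
        ultimately have ks: "\<bar>k / R - sinc (x - y)\<bar> \<le> \<epsilon> / 4" by linarith
        have "l * (k / R) - sinc (x - y) = l * (k / R - sinc (x - y)) + (l - 1) * sinc (x - y)"
          by (simp add: algebra_simps)
        also have "\<bar>\<dots>\<bar> \<le> \<bar>l\<bar> * \<bar>k / R - sinc (x - y)\<bar> + \<bar>l - 1\<bar> * \<bar>sinc (x - y)\<bar>"
          by (simp only: abs_mult[symmetric] abs_triangle_ineq)
        also have "\<dots> \<le> 2 * (\<epsilon> / 4) + \<bar>l - 1\<bar> * 1"
          using l2 ks abs_sinc_le_1 by (intro add_mono mult_mono) auto
        also have "\<dots> < \<epsilon>" using l(3) \<epsilon> by simp
        finally have "\<bar>l * (k / R) - sinc (x - y)\<bar> < \<epsilon>" .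
        moreover have "l * (k / R) = 2 / of_int (N R) * k" "l * x / R = 2 * x / of_int (N R)" "l * y / R = 2 * y / of_int (N R)"
          using elim(3) by (auto simp: l_def)
        ultimately show "dist (2 / of_int (N R) * poly_kernel (nat (N R)) (zero_weight p R) (2 * x / of_int (N R)) (2 * y / of_int (N R)))
            (sine_kernel x y) < \<epsilon>"
          by (simp add: dist_real_def sine_kernel_eq_sinc k_def)
      qed
    qed
  qed
qed

end
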